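(* There exist universal constants $C_0, c, C > 0$ such that the following holds. Let $X \subset \mathbb{R}^m$ be a finite nonempty set with doubling dimension $d_X$, let $d \ge 1$ be an integer with $d \ge C_0 \cdot d_X$, and let $G$ be a random projection from $\mathbb{R}^m$ to $\mathbb{R}^d$. Let $\mathcal{F}_m$ be an optimal facility location solution for $X$ in $\mathbb{R}^m$ and let $\mathcal{F}_d$ be an optimal facility location solution for the dataset $GX = \{Gx : x \in X\} \subset \mathbb{R}^d$. Then $$ c \cdot \mathrm{cost}(\mathcal{F}_m) \le \mathbb{E}[\mathrm{cost}(\mathcal{F}_d)] \le C \cdot \mathrm{cost}(\mathcal{F}_m),$$ where $\mathrm{cost}(\mathcal{F}_m)$ is evaluated for the dataset $X$, $\mathrm{cost}(\mathcal{F}_d)$ is evaluated for the dataset $GX$, and the expectation is over $G$.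
   Context: All norms are Euclidean. Facility location (uniform, opening cost 1): for a finite nonempty dataset $Y$ in a Euclidean space, a solution is a nonempty subset $\mathcal{F} \subseteq Y$, with cost $\mathrm{cost}(\mathcal{F}) = |\mathcal{F}| + \sum_{y \in Y} \min_{f \in \mathcal{F}} \|y - f\|$; an optimal solution is one minimizing this cost. Doubling dimension: for $x \in X$, $r > 0$ let $B(x,r) = \{y \in X : \|x-y\| \le r\}$. The doubling constant $\lambda_X$ is the smallest $\lambda$ such that for all $x \in X$, $r > 0$ there is $S \subseteq X$ with $|S| \le \lambda$ and $B(x,r) \subseteq \bigcup_{s \in S} B(s, r/2)$. The doubling dimension is $d_X = \log_2 \lambda_X$. A random projection from $\mathbb{R}^m$ to $\mathbb{R}^d$ is a random linear map $G$ given by a $d \times m$ matrix with i.i.d. entries drawn from $\mathcal{N}(0, 1/d)$ (Gaussian with variance $1/d$). Almost surely $G$ is injective on $X$. *)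

theory Defs
  imports "HOL-Probability.Probability"
begin

text \<open>
  The constants of the theorem must not depend on the dimensions, so \<open>\<real>\<^sup>n\<close> is not an index type
  but the carrier \<^term>\<open>topspace (Euclidean_space n)\<close>: functions
  \<^typ>\<open>nat \<Rightarrow> real\<close> that vanish at all indices \<open>\<ge> n\<close>.
\<close>

definition euclid_dist :: "nat \<Rightarrow> (nat \<Rightarrow> real) \<Rightarrow> (nat \<Rightarrow> real) \<Rightarrow> real" where
  "euclid_dist n x y = L2_set (\<lambda>i. x i - y i) {..<n}"

definition fl_cost :: "nat \<Rightarrow> (nat \<Rightarrow> real) set \<Rightarrow> (nat \<Rightarrow> real) set \<Rightarrow> real" where
  "fl_cost n Y F = real (card F) + (\<Sum>y\<in>Y. Min ((\<lambda>f. euclid_dist n y f) ` F))"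

definition fl_solution :: "(nat \<Rightarrow> real) set \<Rightarrow> (nat \<Rightarrow> real) set \<Rightarrow> bool" where
  "fl_solution Y F \<longleftrightarrow> F \<noteq> {} \<and> F \<subseteq> Y"

definition fl_optimal :: "nat \<Rightarrow> (nat \<Rightarrow> real) set \<Rightarrow> (nat \<Rightarrow> real) set \<Rightarrow> bool" where
  "fl_optimal n Y F \<longleftrightarrow>
     fl_solution Y F \<and> (\<forall>F'. fl_solution Y F' \<longrightarrow> fl_cost n Y F \<le> fl_cost n Y F')"

definition ball_in :: "nat \<Rightarrow> (nat \<Rightarrow> real) set \<Rightarrow> (nat \<Rightarrow> real) \<Rightarrow> real \<Rightarrow> (nat \<Rightarrow> real) set" where
  "ball_in n X x r = {y \<in> X. euclid_dist n x y \<le> r}"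

definition doubling_const :: "nat \<Rightarrow> (nat \<Rightarrow> real) set \<Rightarrow> nat" where
  "doubling_const n X =
     (LEAST k. \<forall>x\<in>X. \<forall>r>0. \<exists>S\<subseteq>X. finite S \<and> card S \<le> k \<and>
        ball_in n X x r \<subseteq> (\<Union>s\<in>S. ball_in n X s (r / 2)))"

definition doubling_dim :: "nat \<Rightarrow> (nat \<Rightarrow> real) set \<Rightarrow> real" where
  "doubling_dim n X = log 2 (real (doubling_const n X))"

text \<open>
  The law of a \<open>d \<times> m\<close> matrix with i.i.d. entries \<open>N(0, 1/d)\<close>; the second parameter of
  \<^const>\<open>normal_density\<close> is the standard deviation.
\<close>

definition gaussian_matrix :: "nat \<Rightarrow> nat \<Rightarrow> (nat \<times> nat \<Rightarrow> real) measure" where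
  "gaussian_matrix d m =
     Pi\<^sub>M ({..<d} \<times> {..<m})
       (\<lambda>_. density lborel (\<lambda>t. ennreal (normal_density 0 (1 / sqrt (real d)) t)))"

definition mat_apply :: "nat \<Rightarrow> nat \<Rightarrow> (nat \<times> nat \<Rightarrow> real) \<Rightarrow> (nat \<Rightarrow> real) \<Rightarrow> (nat \<Rightarrow> real)" where
  "mat_apply d m G x = (\<lambda>i. if i < d then \<Sum>j<m. G (i, j) * x j else 0)"

end

theory Submission
  imports Defs
begin

text \<open>
  Let \<open>r\<^sub>x\<close> be the Mettu--Plaxton radius of \<open>x \<in> X\<close>, the solution of
  \<open>(\<Sum>q\<in>X. max 0 (r - D x q)) = 1\<close>. The optimal facility location cost is \<open>\<Sum>x\<in>X. r\<^sub>x\<close> up to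
  constant factors, in \<open>X\<close> as well as in \<open>G X\<close>. With probability at least \<open>1/2\<close> no point at distance
  more than \<open>r\<^sub>x / 2\<close> from \<open>x\<close> is mapped to within a small multiple of \<open>r\<^sub>x\<close> of \<open>G x\<close>: cover each annulus around \<open>x\<close>
  by small balls, use the lower tail of \<open>\<parallel>G v\<parallel>\<close> for their centers, and bound the stretch of \<open>G\<close> on the
  balls by chaining. Then the radius of \<open>G x\<close> is at least a small multiple of \<open>r\<^sub>x\<close>, and taking
  expectations gives the lower bound. The upper bound holds with \<open>C = 1\<close> because
  \<open>E \<parallel>G v\<parallel> \<le> \<parallel>v\<parallel>\<close>: open the projections of the facilities of \<open>X\<close>.
\<close>

section \<open>Mettu--Plaxton radii\<close>

text \<open>An arbitrary distance function is allowed so that the metric of \<open>X\<close> and its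
  pullback along a projection can be compared on the same set of points.\<close>

definition pm_cost :: "('a \<Rightarrow> 'a \<Rightarrow> real) \<Rightarrow> 'a set \<Rightarrow> 'a set \<Rightarrow> real" where
  "pm_cost D X F = real (card F) + (\<Sum>x\<in>X. Min (D x ` F))"

text \<open>The positive part restricts the sum to the ball of radius \<open>r\<close> around
  \<open>x\<close> while keeping it continuous in \<open>r\<close>.\<close>

definition ball_mass :: "('a \<Rightarrow> 'a \<Rightarrow> real) \<Rightarrow> 'a set \<Rightarrow> 'a \<Rightarrow> real \<Rightarrow> real" where
  "ball_mass D X x r = (\<Sum>q\<in>X. max 0 (r - D x q))"

text \<open>For \<open>x\<close> in \<open>X\<close> the choice is determined: a solution exists by
  \<open>mp_radius_exists\<close>, and \<open>ball_mass_increment\<close> makes it unique.\<close>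

definition mp_radius :: "('a \<Rightarrow> 'a \<Rightarrow> real) \<Rightarrow> 'a set \<Rightarrow> 'a \<Rightarrow> real" where
  "mp_radius D X x = (SOME r. r > 0 \<and> ball_mass D X x r = 1)"

text \<open>Distinct points may have distance 0, because a degenerate matrix can identify points of
  \<open>X\<close>.\<close>

locale finite_pseudometric =
  fixes X :: "'a set" and D :: "'a \<Rightarrow> 'a \<Rightarrow> real"
  assumes finite_points: "finite X"
    and self_zero: "x \<in> X \<Longrightarrow> D x x = 0"
    and nonneg: "x \<in> X \<Longrightarrow> y \<in> X \<Longrightarrow> 0 \<le> D x y"
    and commute: "x \<in> X \<Longrightarrow> y \<in> X \<Longrightarrow> D x y = D y x"
    and triangle: "x \<in> X \<Longrightarrow> y \<in> X \<Longrightarrow> z \<in> X \<Longrightarrow> D x z \<le> D x y + D y z"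
begin

text \<open>Intermediate value theorem on \<open>{0..1}\<close>: the mass vanishes at radius 0, and
  at radius 1 the point \<open>x\<close> alone contributes 1.\<close>

lemma mp_radius_exists:
  assumes x: "x \<in> X"
  shows "\<exists>r>0. ball_mass D X x r = 1"
proof -
  have "continuous_on {0..1} (ball_mass D X x)"
    unfolding ball_mass_def by (intro continuous_intros)
  moreover have "ball_mass D X x 0 = 0"
    unfolding ball_mass_def using nonneg[OF x] by (intro sum.neutral) (simp add: max_def order_antisym)
  moreover have "ball_mass D X x 1 \<ge> 1"
  proof -
    have "1 \<le> max 0 (1 - D x x)" using self_zero[OF x] by simp
    also have "\<dots> \<le> ball_mass D X x 1"
      unfolding ball_mass_def by (rule member_le_sum) (use x finite_points in auto)
    finally show ?thesis .
  qed
  ultimately obtain r where "0 \<le> r" "r \<le> 1" "ball_mass D X x r = 1"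
    using IVT'[of "ball_mass D X x" 0 1 1] by auto
  moreover have "r \<noteq> 0" using \<open>ball_mass D X x 0 = 0\<close> \<open>ball_mass D X x r = 1\<close> by auto
  ultimately show ?thesis by (intro exI[of _ r]) auto
qed

lemma
  assumes "x \<in> X"
  shows mp_radius_pos: "0 < mp_radius D X x"
    and ball_mass_mp_radius: "ball_mass D X x (mp_radius D X x) = 1"
  using someI_ex[OF mp_radius_exists[OF assms]] unfolding mp_radius_def by auto

text \<open>The term of \<open>x\<close> itself grows with slope 1 and no other term decreases. This
  strict growth turns bounds on the mass into bounds on the radius.\<close>

lemma ball_mass_increment:
  assumes x: "x \<in> X" and r: "0 \<le> r" "r \<le> s"
  shows "ball_mass D X x r + (s - r) \<le> ball_mass D X x s"
proof -
  have "(s - r) \<le> max 0 (s - D x x) - max 0 (r - D x x)"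
    using self_zero[OF x] r by auto
  also have "\<dots> \<le> (\<Sum>q\<in>X. max 0 (s - D x q) - max 0 (r - D x q))"
    by (rule member_le_sum) (use x r finite_points in auto)
  finally show ?thesis by (simp add: ball_mass_def sum_subtractf)
qed

lemma mp_radius_leI:
  assumes x: "x \<in> X" and r: "0 \<le> r" "1 \<le> ball_mass D X x r"
  shows "mp_radius D X x \<le> r"
  using ball_mass_increment[OF x, of r "mp_radius D X x"] ball_mass_mp_radius[OF x] r by linarith

lemma mp_radius_geI:
  assumes x: "x \<in> X" and r: "ball_mass D X x r \<le> 1"
  shows "r \<le> mp_radius D X x"
  using ball_mass_increment[OF x, of "mp_radius D X x" r] ball_mass_mp_radius[OF x]
    mp_radius_pos[OF x] r by linarith

text \<open>Enlarging the radius by \<open>D x y\<close> compensates for moving the centre from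
  \<open>y\<close> to \<open>x\<close>, term by term, so the mass at \<open>x\<close> is already at
  least 1.\<close>

lemma mp_radius_lipschitz:
  assumes x: "x \<in> X" and y: "y \<in> X"
  shows "mp_radius D X x \<le> mp_radius D X y + D x y"
proof (rule mp_radius_leI[OF x])
  show "0 \<le> mp_radius D X y + D x y" using mp_radius_pos[OF y] nonneg[OF x y] by simp
  have "ball_mass D X y (mp_radius D X y) \<le> ball_mass D X x (mp_radius D X y + D x y)"
    unfolding ball_mass_def
  proof (rule sum_mono)
    fix q assume "q \<in> X"
    then have "D x q \<le> D x y + D y q" using triangle x y by blast
    then show "max 0 (mp_radius D X y - D y q) \<le> max 0 (mp_radius D X y + D x y - D x q)" by auto
  qed
  then show "1 \<le> ball_mass D X x (mp_radius D X y + D x y)"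
    by (simp add: ball_mass_mp_radius[OF y])
qed

text \<open>Each point within half the radius contributes at least
  \<open>mp_radius D X x / 2\<close> to the total mass 1. This bounds the number of points that a
  projection may bring arbitrarily close to \<open>x\<close>.\<close>

lemma card_half_ball:
  assumes x: "x \<in> X"
  shows "real (card {q \<in> X. D x q \<le> mp_radius D X x / 2}) * (mp_radius D X x / 2) \<le> 1"
proof -
  have "real (card {q \<in> X. D x q \<le> mp_radius D X x / 2}) * (mp_radius D X x / 2) =
      (\<Sum>q\<in>{q \<in> X. D x q \<le> mp_radius D X x / 2}. mp_radius D X x / 2)"
    by simp
  also have "\<dots> \<le> (\<Sum>q\<in>{q \<in> X. D x q \<le> mp_radius D X x / 2}. max 0 (mp_radius D X x - D x q))"
    by (rule sum_mono) (auto simp: max_def)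
  also have "\<dots> \<le> ball_mass D X x (mp_radius D X x)"
    unfolding ball_mass_def by (rule sum_mono2) (use finite_points in auto)
  finally show ?thesis by (simp add: ball_mass_mp_radius[OF x])
qed

text \<open>
  Inside the cluster of a facility \<open>f\<close> the Lipschitz property gives
  \<open>r\<^sub>x \<le> (r\<^sub>f - D x f) + 2 D x f\<close>, and the first terms sum to at most the mass \<open>1\<close> of \<open>f\<close>.
\<close>

lemma sum_mp_radius_le_cost:
  assumes F: "F \<noteq> {}" "F \<subseteq> X"
  shows "(\<Sum>x\<in>X. mp_radius D X x) \<le> 2 * pm_cost D X F"
proof -
  have finF: "finite F" using F(2) finite_points finite_subset by blast
  define n where "n x = (SOME f. f \<in> F \<and> D x f = Min (D x ` F))" for x
  have n: "n x \<in> F \<and> D x (n x) = Min (D x ` F)" for x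
  proof -
    have "Min (D x ` F) \<in> D x ` F" using finF assms(1) by (intro Min_in) auto
    then have "\<exists>f. f \<in> F \<and> D x f = Min (D x ` F)" by (metis imageE)
    from someI_ex[OF this] show ?thesis by (simp add: n_def)
  qed
  have "(\<Sum>x\<in>X. mp_radius D X x) \<le> (\<Sum>x\<in>X. max 0 (mp_radius D X (n x) - D (n x) x) + 2 * D x (n x))"
  proof (rule sum_mono)
    fix x assume x: "x \<in> X"
    have nx: "n x \<in> X" using n F by blast
    show "mp_radius D X x \<le> max 0 (mp_radius D X (n x) - D (n x) x) + 2 * D x (n x)"
      using mp_radius_lipschitz[OF x nx] commute[OF x nx] by simp
  qed
  also have "\<dots> = (\<Sum>f\<in>F. \<Sum>x\<in>{x \<in> X. n x = f}. max 0 (mp_radius D X f - D f x)) + 2 * (\<Sum>x\<in>X. Min (D x ` F))"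
  proof -
    have "(\<Sum>x\<in>X. max 0 (mp_radius D X (n x) - D (n x) x)) =
       (\<Sum>f\<in>F. \<Sum>x\<in>{x \<in> X. n x = f}. max 0 (mp_radius D X (n x) - D (n x) x))"
      by (rule sum.group[symmetric]) (use n finF finite_points in auto)
    also have "\<dots> = (\<Sum>f\<in>F. \<Sum>x\<in>{x \<in> X. n x = f}. max 0 (mp_radius D X f - D f x))"
      by (intro sum.cong) auto
    finally show ?thesis using n by (simp add: sum.distrib sum_distrib_left)
  qed
  also have "\<dots> \<le> (\<Sum>f\<in>F. 1) + 2 * (\<Sum>x\<in>X. Min (D x ` F))"
  proof (intro add_right_mono sum_mono)
    fix f assume "f \<in> F"
    then have f: "f \<in> X" using F by blast
    have "(\<Sum>x\<in>{x \<in> X. n x = f}. max 0 (mp_radius D X f - D f x)) \<le> ball_mass D X f (mp_radius D X f)"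
      unfolding ball_mass_def by (rule sum_mono2) (use finite_points in auto)
    then show "(\<Sum>x\<in>{x \<in> X. n x = f}. max 0 (mp_radius D X f - D f x)) \<le> 1"
      by (simp add: ball_mass_mp_radius[OF f])
  qed
  also have "\<dots> \<le> 2 * pm_cost D X F"
    by (simp add: pm_cost_def)
  finally show ?thesis .
qed

text \<open>This is the greedy algorithm that scans the points by increasing radius. The induction
  removes a point \<open>x\<close> of largest radius and adds it to the net of the remaining points
  only if no net point lies within \<open>2 * r x\<close>; then
  \<open>r f + r x \<le> 2 * r x < D x f\<close> for every net point \<open>f\<close>.\<close>

lemma greedy_net:
  fixes r :: "'a \<Rightarrow> real"
  assumes "Y \<subseteq> X" and r: "\<And>x. x \<in> X \<Longrightarrow> 0 \<le> r x"
  shows "\<exists>F\<subseteq>Y. (\<forall>x\<in>Y. \<exists>f\<in>F. D x f \<le> 2 * r x) \<and>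
           (\<forall>f\<in>F. \<forall>g\<in>F. f \<noteq> g \<longrightarrow> r f + r g < D f g)"
  using finite_subset[OF assms(1) finite_points] assms(1)
proof (induction Y rule: finite_psubset_induct)
  case (psubset Y)
  show ?case
  proof (cases "Y = {}")
    case False
    have "Max (r ` Y) \<in> r ` Y" using psubset.hyps False by (intro Max_in) auto
    then obtain x where x: "x \<in> Y" "r x = Max (r ` Y)" by (metis imageE)
    then have x_max: "r y \<le> r x" if "y \<in> Y" for y
      using that psubset.hyps by simp
    have sub: "Y - {x} \<subset> Y" "Y - {x} \<subseteq> X" using x psubset.prems by auto
    obtain F where F: "F \<subseteq> Y - {x}" "\<forall>y\<in>Y - {x}. \<exists>f\<in>F. D y f \<le> 2 * r y"
        "\<forall>f\<in>F. \<forall>g\<in>F. f \<noteq> g \<longrightarrow> r f + r g < D f g"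
      using psubset.IH[OF sub] by (elim exE conjE)
    show ?thesis
    proof (cases "\<exists>f\<in>F. D x f \<le> 2 * r x")
      case True
      show ?thesis
      proof (intro exI[of _ F] conjI ballI)
        show "F \<subseteq> Y" using F(1) by blast
        show "\<exists>f\<in>F. D y f \<le> 2 * r y" if "y \<in> Y" for y
          using that True F(2) by (cases "y = x") auto
      qed (use F(3) in blast)
    next
      case far: False
      have sep: "r f + r x < D x f \<and> r f + r x < D f x" if "f \<in> F" for f
      proof -
        have "2 * r x < D x f" using far that by (simp add: not_le)
        moreover have "r f \<le> r x" using x_max F(1) that by blast
        moreover have "D x f = D f x" using commute x(1) F(1) that psubset.prems by blast
        ultimately show ?thesis by linarith
      qed
      show ?thesis
      proof (intro exI[of _ "insert x F"] conjI ballI impI)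
        show "insert x F \<subseteq> Y" using F x by blast
      next
        fix y assume y: "y \<in> Y"
        have "x \<in> X" using x(1) psubset.prems by blast
        then have "D x x \<le> 2 * r x" using self_zero[of x] r[of x] by simp
        then show "\<exists>f\<in>insert x F. D y f \<le> 2 * r y" using F y by (cases "y = x") auto
      next
        fix f g assume "f \<in> insert x F" "g \<in> insert x F" "f \<noteq> g"
        then show "r f + r g < D f g" using F(3) sep[of f] sep[of g] by (auto simp: add.commute)
      qed
    qed
  qed simp
qed

text \<open>
  The balls \<open>B(f, r\<^sub>f)\<close> around the chosen facilities are disjoint, and each contains total
  radius at least its mass \<open>1\<close> because \<open>r\<^sub>q \<ge> r\<^sub>f - D f q\<close>.
\<close>

lemma ex_cost_le_sum_mp_radius:
  assumes "X \<noteq> {}"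
  shows "\<exists>F. F \<noteq> {} \<and> F \<subseteq> X \<and> pm_cost D X F \<le> 3 * (\<Sum>x\<in>X. mp_radius D X x)"
proof -
  let ?r = "mp_radius D X"
  have r_nonneg: "0 \<le> ?r x" if "x \<in> X" for x using mp_radius_pos[OF that] by simp
  have "\<exists>F\<subseteq>X. (\<forall>x\<in>X. \<exists>f\<in>F. D x f \<le> 2 * ?r x) \<and>
      (\<forall>f\<in>F. \<forall>g\<in>F. f \<noteq> g \<longrightarrow> ?r f + ?r g < D f g)"
    by (rule greedy_net[OF order_refl]) (rule r_nonneg)
  then obtain F where F: "F \<subseteq> X" "\<forall>x\<in>X. \<exists>f\<in>F. D x f \<le> 2 * ?r x"
      "\<forall>f\<in>F. \<forall>g\<in>F. f \<noteq> g \<longrightarrow> ?r f + ?r g < D f g"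
    by (elim exE conjE)
  have finF: "finite F" using F(1) finite_points finite_subset by blast
  have neF: "F \<noteq> {}" using F(2) assms by auto
  define B where "B f = {q \<in> X. D f q < ?r f}" for f
  have "real (card F) = (\<Sum>f\<in>F. 1)" by simp
  also have "\<dots> \<le> (\<Sum>f\<in>F. \<Sum>q\<in>B f. ?r q)"
  proof (rule sum_mono)
    fix f assume "f \<in> F"
    then have f: "f \<in> X" using F(1) by blast
    have "1 = (\<Sum>q\<in>X. max 0 (?r f - D f q))"
      using ball_mass_mp_radius[OF f] by (simp add: ball_mass_def)
    also have "\<dots> = (\<Sum>q\<in>B f. max 0 (?r f - D f q))"
      unfolding B_def by (rule sum.mono_neutral_right) (use finite_points in \<open>auto simp: max_def\<close>)
    also have "\<dots> \<le> (\<Sum>q\<in>B f. ?r q)"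
    proof (rule sum_mono)
      fix q assume q: "q \<in> B f"
      then show "max 0 (?r f - D f q) \<le> ?r q"
        using mp_radius_lipschitz[OF f, of q] mp_radius_pos[of q] by (auto simp: B_def)
    qed
    finally show "1 \<le> (\<Sum>q\<in>B f. ?r q)" .
  qed
  also have "\<dots> = (\<Sum>q\<in>(\<Union>f\<in>F. B f). ?r q)"
  proof (rule sum.UNION_disjoint[symmetric])
    show "\<forall>f\<in>F. \<forall>g\<in>F. f \<noteq> g \<longrightarrow> B f \<inter> B g = {}"
    proof (intro ballI impI)
      fix f g assume fg: "f \<in> F" "g \<in> F" "f \<noteq> g"
      have False if "q \<in> B f" "q \<in> B g" for q
      proof -
        have "f \<in> X" "g \<in> X" "q \<in> X" using that fg(1,2) F(1) by (auto simp: B_def)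
        then have "D f g \<le> D f q + D q g" "D q g = D g q"
          using triangle[of f q g] commute[of q g] by auto
        moreover have "?r f + ?r g < D f g" by (rule F(3)[rule_format, OF fg])
        ultimately show False using that by (simp add: B_def)
      qed
      then show "B f \<inter> B g = {}" by blast
    qed
    show "\<forall>f\<in>F. finite (B f)" using finite_points by (simp add: B_def)
  qed (rule finF)
  also have "\<dots> \<le> (\<Sum>q\<in>X. ?r q)"
    by (rule sum_mono2) (use finite_points r_nonneg in \<open>auto simp: B_def\<close>)
  finally have "real (card F) \<le> (\<Sum>q\<in>X. ?r q)" .
  moreover have "(\<Sum>x\<in>X. Min (D x ` F)) \<le> (\<Sum>x\<in>X. 2 * ?r x)"
  proof (rule sum_mono)
    fix x assume "x \<in> X"
    then obtain f where "f \<in> F" "D x f \<le> 2 * ?r x" using F(2) by blast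
    then show "Min (D x ` F) \<le> 2 * ?r x"
      using finF by (intro order_trans[OF Min_le]) auto
  qed
  ultimately have "pm_cost D X F \<le> 3 * (\<Sum>x\<in>X. ?r x)"
    unfolding pm_cost_def by (simp add: sum_distrib_left[symmetric])
  then show ?thesis using F(1) neF by blast
qed

end

section \<open>Norms of Gaussian projections\<close>

text \<open>The integrand is \<open>1 / k\<close> times the centred normal density of standard
  deviation \<open>\<tau> / k\<close>. Negative \<open>s\<close> is included; it yields the lower
  tail of projected norms.\<close>

lemma nn_integral_exp_square_normal:
  fixes s \<tau> :: real
  assumes "\<tau> > 0" and s: "2 * s * \<tau>\<^sup>2 < 1"
  shows "(\<integral>\<^sup>+x. ennreal (normal_density 0 \<tau> x) * ennreal (exp (s * x\<^sup>2)) \<partial>lborel) =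
    ennreal (1 / sqrt (1 - 2 * s * \<tau>\<^sup>2))"
proof -
  define k where "k = sqrt (1 - 2 * s * \<tau>\<^sup>2)"
  have k: "k > 0" "k\<^sup>2 = 1 - 2 * s * \<tau>\<^sup>2" using s by (auto simp: k_def)
  have "normal_density 0 \<tau> x * exp (s * x\<^sup>2) = 1 / k * normal_density 0 (\<tau> / k) x" for x
  proof -
    have "- x\<^sup>2 / (2 * \<tau>\<^sup>2) + s * x\<^sup>2 = - x\<^sup>2 * (1 - 2 * s * \<tau>\<^sup>2) / (2 * \<tau>\<^sup>2)"
      using assms(1) by (simp add: field_simps)
    also have "\<dots> = - x\<^sup>2 / (2 * (\<tau> / k)\<^sup>2)"
      using assms(1) k by (simp add: power_divide)
    finally have e: "exp (- x\<^sup>2 / (2 * \<tau>\<^sup>2)) * exp (s * x\<^sup>2) = exp (- x\<^sup>2 / (2 * (\<tau> / k)\<^sup>2))"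
      by (simp add: exp_add[symmetric])
    have "sqrt (2 * pi * (\<tau> / k)\<^sup>2) = sqrt (2 * pi * \<tau>\<^sup>2) / k"
      using k(1) by (simp add: real_sqrt_mult real_sqrt_divide power_divide del: real_sqrt_eq_iff)
    with e show ?thesis using k(1) by (simp add: normal_density_def mult.assoc)
  qed
  then have "(\<integral>\<^sup>+x. ennreal (normal_density 0 \<tau> x) * ennreal (exp (s * x\<^sup>2)) \<partial>lborel) =
     (\<integral>\<^sup>+x. ennreal (1 / k) * ennreal (normal_density 0 (\<tau> / k) x) \<partial>lborel)"
    using k by (simp add: ennreal_mult'[symmetric])
  also have "\<dots> = ennreal (1 / k)"
    using k assms(1) by (subst nn_integral_cmult) (auto simp: nn_integral_eq_integral)
  finally show ?thesis by (simp add: k_def)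
qed

section \<open>Law of the Gaussian matrix and of its action on a fixed vector\<close>

lemma prob_space_gaussian_matrix:
  assumes "d \<ge> 1"
  shows "prob_space (gaussian_matrix d m)"
  unfolding gaussian_matrix_def using assms
  by (intro prob_space_PiM prob_space_normal_density) simp

lemma space_gaussian_matrix: "space (gaussian_matrix d m) = {..<d} \<times> {..<m} \<rightarrow>\<^sub>E UNIV"
  by (simp add: gaussian_matrix_def space_PiM)

lemma sets_gaussian_matrix [measurable_cong]:
  "sets (gaussian_matrix d m) = sets (\<Pi>\<^sub>M p\<in>{..<d} \<times> {..<m}. (borel :: real measure))"
  unfolding gaussian_matrix_def by (intro sets_PiM_cong) simp_all

lemma measurable_gaussian_entry [measurable]:
  "p \<in> {..<d} \<times> {..<m} \<Longrightarrow> (\<lambda>G. G p) \<in> borel_measurable (gaussian_matrix d m)"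
  by measurable

lemma measurable_mat_apply [measurable]:
  "(\<lambda>G. mat_apply d m G x i) \<in> borel_measurable (gaussian_matrix d m)"
  unfolding mat_apply_def by (cases "i < d") (auto intro!: borel_measurable_sum)

lemma measurable_L2_mat_apply [measurable]:
  "(\<lambda>G. L2_set (mat_apply d m G v) {..<d}) \<in> borel_measurable (gaussian_matrix d m)"
  unfolding L2_set_def by measurable

locale gaussian_projection =
  fixes d m :: nat
  assumes d_pos: "d \<ge> 1"
begin

sublocale prob_space "gaussian_matrix d m"
  using d_pos by (rule prob_space_gaussian_matrix)

lemma distributed_gaussian_entry:
  assumes "p \<in> {..<d} \<times> {..<m}"
  shows "distributed (gaussian_matrix d m) lborel (\<lambda>G. G p) (normal_density 0 (1 / sqrt (real d)))"
  unfolding distributed_def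
proof (intro conjI)
  let ?N = "density lborel (\<lambda>t. ennreal (normal_density 0 (1 / sqrt (real d)) t))"
  have "distr (gaussian_matrix d m) lborel (\<lambda>G. G p) = distr (gaussian_matrix d m) ?N (\<lambda>G. G p)"
    by (rule distr_cong) simp_all
  also have "\<dots> = ?N"
    unfolding gaussian_matrix_def using assms d_pos
    by (intro distr_PiM_component prob_space_normal_density) auto
  finally show "distr (gaussian_matrix d m) lborel (\<lambda>G. G p) = ?N" .
qed (use assms measurable_gaussian_entry[of p d m] in \<open>simp_all add: measurable_lborel1\<close>)

text \<open>The joint law of the coordinates is the product of their marginals, by construction of
  the product measure.\<close>

lemma indep_gaussian_entries:
  "indep_vars (\<lambda>_. borel) (\<lambda>p G. G p) ({..<d} \<times> {..<m})"
proof (cases "{..<d} \<times> {..<m} = {}")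
  \<comment> \<open>Since \<open>d\<close> is positive, this is the case \<open>m = 0\<close>. The
    characterisation of independence by product laws used below requires a nonempty index
    set.\<close>
  case True
  then show ?thesis by (auto simp: indep_vars_def2 indep_sets_def)
next
  case False
  let ?I = "{..<d} \<times> {..<m}" and ?M = "gaussian_matrix d m"
  let ?N = "density lborel (\<lambda>t. ennreal (normal_density 0 (1 / sqrt (real d)) t))"
  have "distr ?M (\<Pi>\<^sub>M i\<in>?I. borel) (\<lambda>x. \<lambda>i\<in>?I. x i) = distr ?M ?M (\<lambda>x. x)"
    by (rule distr_cong) (auto simp: sets_gaussian_matrix space_gaussian_matrix PiE_restrict)
  also have "\<dots> = ?M" by simp
  also have "\<dots> = (\<Pi>\<^sub>M i\<in>?I. distr ?M borel (\<lambda>x. x i))"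
    unfolding gaussian_matrix_def
  proof (rule PiM_cong[OF refl])
    fix p assume p: "p \<in> ?I"
    have "distr (gaussian_matrix d m) borel (\<lambda>G. G p) = distr (gaussian_matrix d m) lborel (\<lambda>G. G p)"
      by (rule distr_cong) simp_all
    then show "?N = distr (\<Pi>\<^sub>M i\<in>?I. ?N) borel (\<lambda>x. x p)"
      using distributed_distr_eq_density[OF distributed_gaussian_entry[OF p]]
      by (simp add: gaussian_matrix_def)
  qed
  finally show ?thesis using False
    by (subst indep_vars_iff_distr_eq_PiM') auto
qed

lemma distributed_mat_apply:
  assumes i: "i < d" and v: "L2_set v {..<m} > 0"
  shows "distributed (gaussian_matrix d m) lborel (\<lambda>G. mat_apply d m G v i)
    (normal_density 0 (L2_set v {..<m} / sqrt (real d)))"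
proof -
  \<comment> \<open>Vanishing coordinates are dropped because \<open>sum_indep_normal\<close>
    requires every summand to have positive standard deviation.\<close>
  define J where "J = {j. j < m \<and> v j \<noteq> 0}"
  have finJ: "finite J" by (simp add: J_def)
  have sumJ: "(\<Sum>j\<in>J. (v j)\<^sup>2) = (\<Sum>j<m. (v j)\<^sup>2)"
    by (rule sum.mono_neutral_left) (auto simp: J_def)
  then have neJ: "J \<noteq> {}" using v by (auto simp: L2_set_def)
  have ind: "indep_vars (\<lambda>_. borel) (\<lambda>p G. v (snd p) * G p) (Pair i ` J)"
    by (rule indep_vars_compose2[OF indep_vars_subset[OF indep_gaussian_entries]])
      (use i in \<open>auto simp: J_def\<close>)
  have "distributed (gaussian_matrix d m) lborel (\<lambda>G. \<Sum>p\<in>Pair i ` J. v (snd p) * G p)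
     (normal_density (\<Sum>p\<in>Pair i ` J. 0) (sqrt (\<Sum>p\<in>Pair i ` J. (\<bar>v (snd p)\<bar> * (1 / sqrt (real d)))\<^sup>2)))"
  proof (rule sum_indep_normal)
    fix p assume p: "p \<in> Pair i ` J"
    show "distributed (gaussian_matrix d m) lborel (\<lambda>G. v (snd p) * G p)
        (normal_density 0 (\<bar>v (snd p)\<bar> * (1 / sqrt (real d))))"
      using normal_density_affine[OF distributed_gaussian_entry, of p "v (snd p)" 0] p d_pos i
      by (auto simp: J_def)
    show "0 < \<bar>v (snd p)\<bar> * (1 / sqrt (real d))"
      using p d_pos by (auto simp: J_def)
  qed (use finJ neJ ind in auto)
  moreover have "(\<Sum>p\<in>Pair i ` J. v (snd p) * G p) = mat_apply d m G v i" for G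
  proof -
    have "(\<Sum>p\<in>Pair i ` J. v (snd p) * G p) = (\<Sum>j\<in>J. v j * G (i, j))"
      by (subst sum.reindex) (auto simp: inj_on_def)
    also have "\<dots> = (\<Sum>j<m. v j * G (i, j))"
      by (rule sum.mono_neutral_left) (auto simp: J_def)
    finally show ?thesis using i by (simp add: mat_apply_def mult.commute)
  qed
  moreover have "sqrt (\<Sum>p\<in>Pair i ` J. (\<bar>v (snd p)\<bar> * (1 / sqrt (real d)))\<^sup>2) = L2_set v {..<m} / sqrt (real d)"
  proof -
    have "(\<Sum>p\<in>Pair i ` J. (\<bar>v (snd p)\<bar> * (1 / sqrt (real d)))\<^sup>2) = (\<Sum>j\<in>J. (v j)\<^sup>2 / real d)"
      by (subst sum.reindex) (auto simp: inj_on_def power_divide)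
    also have "\<dots> = (\<Sum>j<m. (v j)\<^sup>2) / real d"
      by (simp add: sum_divide_distrib[symmetric] sumJ)
    finally show ?thesis by (simp add: L2_set_def real_sqrt_divide)
  qed
  ultimately show ?thesis by simp
qed

text \<open>Different coordinates of the image are functions of disjoint rows of the matrix.\<close>

lemma indep_mat_apply:
  "indep_vars (\<lambda>_. borel) (\<lambda>i G. mat_apply d m G v i) {..<d}"
proof -
  have "indep_vars (\<lambda>i. Pi\<^sub>M ({i} \<times> {..<m}) (\<lambda>_. borel))
      (\<lambda>i G. restrict (\<lambda>p. G p) ({i} \<times> {..<m})) {..<d}"
    by (rule indep_vars_restrict[OF indep_gaussian_entries])
      (auto simp: disjoint_family_on_def)
  then have "indep_vars (\<lambda>_. borel)
      (\<lambda>i G. (\<lambda>g. \<Sum>j<m. g (i, j) * v j) (restrict (\<lambda>p. G p) ({i} \<times> {..<m}))) {..<d}"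
    by (rule indep_vars_compose2) (auto intro!: borel_measurable_sum borel_measurable_times)
  then show ?thesis
    by (rule indep_vars_cong[THEN iffD1, rotated -1]) (auto simp: mat_apply_def fun_eq_iff)
qed

section \<open>Exponential moments, tails and mean of the projected norm\<close>

lemma exp_moment_mat_apply:
  assumes v: "L2_set v {..<m} > 0" and s: "2 * s * (L2_set v {..<m})\<^sup>2 < d"
  shows "(\<integral>\<^sup>+G. ennreal (exp (s * (L2_set (mat_apply d m G v) {..<d})\<^sup>2)) \<partial>gaussian_matrix d m) =
    ennreal ((1 / sqrt (1 - 2 * s * (L2_set v {..<m})\<^sup>2 / d)) ^ d)"
proof -
  let ?M = "gaussian_matrix d m" and ?v = "L2_set v {..<m}"
  let ?Y = "\<lambda>i G. mat_apply d m G v i"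
  have "(\<integral>\<^sup>+G. ennreal (exp (s * (L2_set (mat_apply d m G v) {..<d})\<^sup>2)) \<partial>?M) =
     (\<integral>\<^sup>+G. (\<Prod>i<d. ennreal (exp (s * (?Y i G)\<^sup>2))) \<partial>?M)"
    by (simp add: prod_ennreal L2_set_def sum_nonneg sum_distrib_left exp_sum)
  also have "\<dots> = (\<Prod>i<d. \<integral>\<^sup>+G. ennreal (exp (s * (?Y i G)\<^sup>2)) \<partial>?M)"
    by (rule indep_vars_nn_integral)
      (auto intro!: indep_vars_compose2[OF indep_mat_apply])
  also have "\<dots> = (\<Prod>i<d. ennreal (1 / sqrt (1 - 2 * s * ?v\<^sup>2 / d)))"
  proof (rule prod.cong[OF refl])
    fix i assume "i \<in> {..<d}"
    then have i: "i < d" by simp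
    have "(\<integral>\<^sup>+G. ennreal (exp (s * (?Y i G)\<^sup>2)) \<partial>?M) =
      (\<integral>\<^sup>+x. ennreal (normal_density 0 (?v / sqrt d) x) * ennreal (exp (s * x\<^sup>2)) \<partial>lborel)"
      by (rule distributed_nn_integral[OF distributed_mat_apply[OF i v], symmetric]) simp
    also have "\<dots> = ennreal (1 / sqrt (1 - 2 * s * ?v\<^sup>2 / d))"
      using v s d_pos by (subst nn_integral_exp_square_normal) (auto simp: power_divide)
    finally show "(\<integral>\<^sup>+G. ennreal (exp (s * (?Y i G)\<^sup>2)) \<partial>?M) = ennreal (1 / sqrt (1 - 2 * s * ?v\<^sup>2 / d))" .
  qed
  also have "\<dots> = ennreal ((1 / sqrt (1 - 2 * s * ?v\<^sup>2 / d)) ^ d)"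
    using s d_pos by (simp add: ennreal_power)
  finally show ?thesis .
qed

text \<open>Markov's inequality for \<open>exp (s * Q^2)\<close>, with \<open>Q\<close> the
  projected norm. Keeping the factor \<open>s\<close> on both sides of the event covers both tails:
  the upper one for \<open>s > 0\<close>, the lower one for \<open>s < 0\<close>.\<close>

lemma chernoff_mat_apply:
  assumes v: "L2_set v {..<m} > 0" and s: "2 * s * (L2_set v {..<m})\<^sup>2 < d"
  shows "prob {G \<in> space (gaussian_matrix d m). s * a\<^sup>2 \<le> s * (L2_set (mat_apply d m G v) {..<d})\<^sup>2}
    \<le> exp (- s * a\<^sup>2) * (1 / sqrt (1 - 2 * s * (L2_set v {..<m})\<^sup>2 / d)) ^ d"
proof -
  let ?M = "gaussian_matrix d m" and ?Q = "\<lambda>G. (L2_set (mat_apply d m G v) {..<d})\<^sup>2"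
  let ?A = "{G \<in> space ?M. s * a\<^sup>2 \<le> s * ?Q G}"
  let ?B = "(1 / sqrt (1 - 2 * s * (L2_set v {..<m})\<^sup>2 / d)) ^ d"
  have B: "0 \<le> ?B" using s d_pos by (auto intro!: zero_le_power)
  have "emeasure ?M ?A = (\<integral>\<^sup>+G. indicator ?A G \<partial>?M)"
    by (rule nn_integral_indicator[symmetric]) simp
  also have "\<dots> \<le> (\<integral>\<^sup>+G. ennreal (exp (- s * a\<^sup>2)) * ennreal (exp (s * ?Q G)) \<partial>?M)"
    by (rule nn_integral_mono)
      (auto simp: indicator_def ennreal_mult'[symmetric] exp_add[symmetric] ennreal_1[symmetric] simp del: ennreal_1)
  also have "\<dots> = ennreal (exp (- s * a\<^sup>2)) * ennreal ?B"
    by (subst nn_integral_cmult) (simp_all add: exp_moment_mat_apply[OF v s])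
  also have "\<dots> = ennreal (exp (- s * a\<^sup>2) * ?B)"
    using B by (simp add: ennreal_mult)
  finally show ?thesis using B by (simp add: emeasure_eq_measure)
qed

lemma prob_stretch:
  assumes "0 \<le> t"
  shows "prob {G \<in> space (gaussian_matrix d m). t * L2_set v {..<m} < L2_set (mat_apply d m G v) {..<d}}
    \<le> exp (real d * (1 / 2 - t\<^sup>2 / 4))"
proof (cases "L2_set v {..<m} = 0")
  case True
  then have "\<forall>j<m. v j = 0" by (simp add: L2_set_eq_0_iff)
  then have "L2_set (mat_apply d m G v) {..<d} = 0" for G
    by (simp add: L2_set_eq_0_iff mat_apply_def)
  then show ?thesis using True by simp
next
  case False
  let ?M = "gaussian_matrix d m" and ?v = "L2_set v {..<m}"
  let ?Q = "\<lambda>G. L2_set (mat_apply d m G v) {..<d}"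
  have v: "?v > 0" using False L2_set_nonneg[of v "{..<m}"] by linarith
  \<comment> \<open>This choice makes \<open>1 - 2 * s * ?v^2 / d\<close> equal to 1/2, so each
    coordinate contributes a factor \<open>sqrt 2\<close>, which is at most
    \<open>exp (1 / 2)\<close>.\<close>
  define s where "s = d / (4 * ?v\<^sup>2)"
  have s: "s > 0" "s * ?v\<^sup>2 = d / 4" using v d_pos by (auto simp: s_def)
  have "prob {G \<in> space ?M. t * ?v < ?Q G} \<le> prob {G \<in> space ?M. s * (t * ?v)\<^sup>2 \<le> s * (?Q G)\<^sup>2}"
    using s v assms by (intro finite_measure_mono) (auto intro!: power_mono)
  also have "\<dots> \<le> exp (- s * (t * ?v)\<^sup>2) * (1 / sqrt (1 - 2 * s * ?v\<^sup>2 / d)) ^ d"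
    using s d_pos by (intro chernoff_mat_apply[OF v]) (simp add: mult.assoc)
  also have "1 / sqrt (1 - 2 * s * ?v\<^sup>2 / d) = sqrt 2"
  proof -
    have "1 - 2 * s * ?v\<^sup>2 / d = 1 - 2 * (d / 4) / d" by (simp only: s(2)[symmetric] mult.assoc)
    also have "\<dots> = 1 / 2" using d_pos by simp
    finally have half: "1 - 2 * s * ?v\<^sup>2 / d = 1 / 2" .
    show ?thesis unfolding half by (simp add: real_sqrt_divide)
  qed
  also have "sqrt 2 ^ d \<le> exp (1 / 2) ^ d"
  proof (rule power_mono)
    have "2 \<le> exp (1 / 2 :: real) ^ 2"
      using exp_ge_add_one_self[of "1::real"] by (simp add: exp_double[symmetric])
    then show "sqrt 2 \<le> exp (1 / 2 :: real)" by (simp add: real_le_lsqrt)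
  qed simp
  also have "exp (- s * (t * ?v)\<^sup>2) * exp (1 / 2) ^ d = exp (real d * (1 / 2 - t\<^sup>2 / 4))"
  proof -
    have "s * (t * ?v)\<^sup>2 = s * ?v\<^sup>2 * t\<^sup>2" by (simp add: power_mult_distrib)
    then have sq: "- s * (t * ?v)\<^sup>2 = - (d / 4 * t\<^sup>2)" by (simp only: s(2) minus_mult_left[symmetric])
    show ?thesis unfolding sq by (simp add: exp_of_nat_mult[symmetric] exp_add[symmetric] algebra_simps)
  qed
  finally show ?thesis by simp
qed

text \<open>A small-ball estimate: the exponent \<open>d\<close> lets it beat the size of a cover,
  which is a power of the doubling constant.\<close>

lemma prob_contract:
  assumes t: "0 < t" and v: "L2_set v {..<m} > 0"
  shows "prob {G \<in> space (gaussian_matrix d m). L2_set (mat_apply d m G v) {..<d} \<le> t * L2_set v {..<m}}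
    \<le> (2 * t) ^ d"
proof -
  let ?M = "gaussian_matrix d m" and ?v = "L2_set v {..<m}"
  let ?Q = "\<lambda>G. L2_set (mat_apply d m G v) {..<d}"
  \<comment> \<open>The Chernoff parameter is \<open>- s\<close>. With this \<open>s\<close> the
    exponential prefactor is \<open>exp (d / 2)\<close>, and
    \<open>1 / sqrt (1 + 1 / t^2) \<le> t\<close> supplies the power of \<open>t\<close>.\<close>
  define s where "s = d / (2 * t\<^sup>2 * ?v\<^sup>2)"
  have s: "s > 0" "s * ?v\<^sup>2 = d / (2 * t\<^sup>2)" using v d_pos t by (auto simp: s_def)
  have "prob {G \<in> space ?M. ?Q G \<le> t * ?v} \<le> prob {G \<in> space ?M. - s * (t * ?v)\<^sup>2 \<le> - s * (?Q G)\<^sup>2}"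
    using s v t by (intro finite_measure_mono) (auto intro!: power_mono)
  also have "\<dots> \<le> exp (- (- s) * (t * ?v)\<^sup>2) * (1 / sqrt (1 - 2 * (- s) * ?v\<^sup>2 / d)) ^ d"
  proof (rule chernoff_mat_apply[OF v])
    have "2 * (- s) * ?v\<^sup>2 \<le> 0" using s by (simp add: mult_nonneg_nonneg)
    then show "2 * (- s) * ?v\<^sup>2 < d" using d_pos by linarith
  qed
  also have "- (- s) * (t * ?v)\<^sup>2 = real d * (1 / 2)"
    using s t by (simp add: power_mult_distrib mult.commute mult.left_commute field_simps)
  also have "1 - 2 * (- s) * ?v\<^sup>2 / d = 1 + 1 / t\<^sup>2"
    using s d_pos by (simp add: mult.assoc)
  also have "exp (real d * (1 / 2)) * (1 / sqrt (1 + 1 / t\<^sup>2)) ^ d = (exp (1 / 2) * (1 / sqrt (1 + 1 / t\<^sup>2))) ^ d"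
    by (simp only: exp_of_nat_mult power_mult_distrib)
  also have "\<dots> \<le> (2 * t) ^ d"
  proof (intro power_mono mult_mono)
    have "exp (1 / 2 :: real) ^ 2 \<le> 2 ^ 2"
      using exp_le by (simp add: exp_double[symmetric])
    then show "exp (1 / 2 :: real) \<le> 2" by (rule power2_le_imp_le) simp
    have "1 / t = sqrt (1 / t\<^sup>2)" using t by (simp add: real_sqrt_divide)
    also have "\<dots> \<le> sqrt (1 + 1 / t\<^sup>2)" by simp
    finally show "1 / sqrt (1 + 1 / t\<^sup>2) \<le> t"
      using t by (simp add: field_simps add_pos_pos)
  qed (use t in auto)
  finally show ?thesis .
qed

text \<open>By the inequality of arithmetic and geometric means, the projected norm is at most
  \<open>h G\<close>, half the sum of \<open>?v\<close> and the squared projected norm divided by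
  \<open>?v\<close>. The second moment is \<open>?v^2\<close>, so \<open>h\<close> is an integrable
  majorant with mean \<open>?v\<close>.\<close>

lemma
  shows integrable_L2_mat_apply: "integrable (gaussian_matrix d m) (\<lambda>G. L2_set (mat_apply d m G v) {..<d})"
    and expectation_L2_mat_apply: "expectation (\<lambda>G. L2_set (mat_apply d m G v) {..<d}) \<le> L2_set v {..<m}"
proof -
  let ?M = "gaussian_matrix d m" and ?v = "L2_set v {..<m}"
  let ?Q = "\<lambda>G. L2_set (mat_apply d m G v) {..<d}"
  have "integrable ?M ?Q \<and> expectation ?Q \<le> ?v"
  proof (cases "?v = 0")
    case True
    then have "\<forall>j<m. v j = 0" by (simp add: L2_set_eq_0_iff)
    then have "?Q G = 0" for G
      by (simp add: L2_set_eq_0_iff mat_apply_def)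
    then show ?thesis using True by simp
  next
    case False
    then have v: "?v > 0" using L2_set_nonneg[of v "{..<m}"] by linarith
    have coord: "has_bochner_integral ?M (\<lambda>G. (mat_apply d m G v i)\<^sup>2) (?v\<^sup>2 / d)" if i: "i < d" for i
    proof -
      note D = distributed_mat_apply[OF i v]
      have "has_bochner_integral lborel (\<lambda>x. normal_density 0 (?v / sqrt d) x * (x - 0) ^ (2 * 1))
         (fact (2 * 1) / ((2 / (?v / sqrt d)\<^sup>2) ^ 1 * fact 1))"
        using v d_pos by (intro normal_moment_even) simp
      then have L: "has_bochner_integral lborel (\<lambda>x. normal_density 0 (?v / sqrt d) x * x\<^sup>2) (?v\<^sup>2 / d)"
        by (simp add: power_divide)
      have "integrable ?M (\<lambda>G. (mat_apply d m G v i)\<^sup>2)"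
        using distributed_integrable[OF D, of "\<lambda>x. x\<^sup>2"] L by (auto simp: has_bochner_integral_iff)
      moreover have "expectation (\<lambda>G. (mat_apply d m G v i)\<^sup>2) = ?v\<^sup>2 / d"
        using distributed_integral[OF D, of "\<lambda>x. x\<^sup>2"] L by (auto simp: has_bochner_integral_iff)
      ultimately show ?thesis by (simp add: has_bochner_integral_iff)
    qed
    have "has_bochner_integral ?M (\<lambda>G. \<Sum>i<d. (mat_apply d m G v i)\<^sup>2) (\<Sum>i<d. ?v\<^sup>2 / d)"
      by (intro has_bochner_integral_sum coord) simp
    then have sq: "has_bochner_integral ?M (\<lambda>G. (?Q G)\<^sup>2) (?v\<^sup>2)"
      using d_pos by (simp add: L2_set_def sum_nonneg)
    define h where "h G = (?v + (?Q G)\<^sup>2 / ?v) / 2" for G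
    have "has_bochner_integral ?M h ((?v * 1 + ?v\<^sup>2 / ?v) / 2)"
      unfolding h_def
      by (intro has_bochner_integral_divide_zero has_bochner_integral_add has_bochner_integral_mult_right sq)
        (auto simp: has_bochner_integral_iff prob_space)
    then have h: "integrable ?M h" "expectation h = ?v"
      using v by (auto simp: has_bochner_integral_iff power2_eq_square)
    have Qh: "?Q G \<le> h G" for G
    proof -
      have "0 \<le> (?v - ?Q G)\<^sup>2" by simp
      then show ?thesis using v by (simp add: h_def field_simps power2_eq_square)
    qed
    have Q: "integrable ?M ?Q"
      by (rule Bochner_Integration.integrable_bound[OF h(1)])
        (use Qh in \<open>auto intro!: AE_I2 order_trans[OF _ abs_ge_self]\<close>)
    moreover have "expectation ?Q \<le> expectation h"
      using Q h(1) Qh by (intro integral_mono) auto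
    ultimately show ?thesis using h by simp
  qed
  then show "integrable ?M ?Q" "expectation ?Q \<le> ?v" by auto
qed

end

section \<open>Random pseudometrics on doubling sets\<close>

text \<open>These are the properties of a Gaussian projection on which the lower bound rests. The
  exponent 22 counts the halvings that take the outer radius \<open>4 * r\<close> of the first
  annulus down to \<open>r / 2^20\<close>; it becomes the constant in the condition on
  \<open>d\<close>.\<close>

locale random_pseudometric = prob_space M + finite_pseudometric X D
  for M :: "'w measure" and X :: "'a set" and D +
  fixes \<rho> :: "'w \<Rightarrow> 'a \<Rightarrow> 'a \<Rightarrow> real" and d lam :: nat
  assumes rho_pseudometric: "\<omega> \<in> space M \<Longrightarrow> finite_pseudometric X (\<rho> \<omega>)"
    and rho_measurable [measurable]: "(\<lambda>\<omega>. \<rho> \<omega> x y) \<in> borel_measurable M"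
    and stretch: "0 \<le> t \<Longrightarrow> x \<in> X \<Longrightarrow> y \<in> X \<Longrightarrow>
      prob {\<omega> \<in> space M. t * D x y < \<rho> \<omega> x y} \<le> exp (real d * (1 / 2 - t\<^sup>2 / 4))"
    and contract: "0 < t \<Longrightarrow> x \<in> X \<Longrightarrow> y \<in> X \<Longrightarrow> x \<noteq> y \<Longrightarrow>
      prob {\<omega> \<in> space M. \<rho> \<omega> x y \<le> t * D x y} \<le> (2 * t) ^ d"
    and dist_pos: "x \<in> X \<Longrightarrow> y \<in> X \<Longrightarrow> x \<noteq> y \<Longrightarrow> 0 < D x y"
    and d_pos: "d \<ge> 1"
    and doubling: "x \<in> X \<Longrightarrow> 0 < r \<Longrightarrow>
      \<exists>S\<subseteq>X. card S \<le> lam \<and> (\<forall>q\<in>X. D x q \<le> r \<longrightarrow> (\<exists>s\<in>S. D s q \<le> r / 2))"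
    and lam_pos: "lam \<ge> 1"
    and lam_le: "real lam ^ 22 \<le> 2 ^ d"
begin

section \<open>Covers, chaining, and the probability of collapse\<close>

lemma iterated_doubling:
  assumes "x \<in> X" "0 < r"
  shows "\<exists>S\<subseteq>X. card S \<le> lam ^ k \<and> (\<forall>q\<in>X. D x q \<le> r \<longrightarrow> (\<exists>s\<in>S. D s q \<le> r / 2 ^ k))"
proof (induction k)
  case 0
  show ?case using assms by (intro exI[of _ "{x}"]) auto
next
  case (Suc k)
  then obtain S where S: "S \<subseteq> X" "card S \<le> lam ^ k"
     "\<And>q. q \<in> X \<Longrightarrow> D x q \<le> r \<Longrightarrow> \<exists>s\<in>S. D s q \<le> r / 2 ^ k" by blast
  have "\<forall>s\<in>S. \<exists>T. T \<subseteq> X \<and> card T \<le> lam \<and> (\<forall>q\<in>X. D s q \<le> r / 2 ^ k \<longrightarrow> (\<exists>t\<in>T. D t q \<le> r / 2 ^ k / 2))"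
    using doubling[of _ "r / 2 ^ k"] S(1) assms by (simp add: subset_iff)
  then obtain T where T: "\<And>s. s \<in> S \<Longrightarrow> T s \<subseteq> X" "\<And>s. s \<in> S \<Longrightarrow> card (T s) \<le> lam"
      "\<And>s q. s \<in> S \<Longrightarrow> q \<in> X \<Longrightarrow> D s q \<le> r / 2 ^ k \<Longrightarrow> \<exists>t\<in>T s. D t q \<le> r / 2 ^ k / 2"
    by metis
  show ?case
  proof (intro exI[of _ "\<Union>s\<in>S. T s"] conjI ballI impI)
    show "(\<Union>s\<in>S. T s) \<subseteq> X" using T(1) by blast
    have finS: "finite S" using S(1) finite_points finite_subset by blast
    have "card (\<Union>s\<in>S. T s) \<le> (\<Sum>s\<in>S. card (T s))"
      by (rule card_UN_le[OF finS])
    also have "\<dots> \<le> (\<Sum>s\<in>S. lam)" by (rule sum_mono) (rule T(2))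
    also have "\<dots> \<le> lam ^ Suc k" using S(2) by (simp add: mult.commute)
    finally show "card (\<Union>s\<in>S. T s) \<le> lam ^ Suc k" .
  next
    fix q assume q: "q \<in> X" "D x q \<le> r"
    then obtain s where s: "s \<in> S" "D s q \<le> r / 2 ^ k" using S(3) by blast
    then obtain t where "t \<in> T s" "D t q \<le> r / 2 ^ k / 2" using T(3)[OF s(1) q(1) s(2)] by blast
    then show "\<exists>s\<in>\<Union>s\<in>S. T s. D s q \<le> r / 2 ^ Suc k"
      using s(1) by (auto simp: field_simps)
  qed
qed

lemma lam_le_exp: "real lam \<le> exp (real d)"
proof -
  have "real lam \<le> real lam ^ 22" using lam_pos by (intro self_le_power) auto
  also have "\<dots> \<le> 2 ^ d" by (rule lam_le)
  also have "\<dots> \<le> exp 1 ^ d" using exp_ge_add_one_self[of 1] by (intro power_mono) auto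
  finally show ?thesis by (simp add: exp_of_nat_mult[symmetric])
qed

text \<open>
  Chaining by induction on the scale. A point \<open>q\<close> of the ball is reached through one of \<open>lam\<close> centers
  \<open>s'\<close> of half the radius: if \<open>\<rho> s q > \<theta> r\<close>, then either \<open>\<rho> s s' > \<theta> r / 3\<close> or
  \<open>\<rho> s' q > (4 \<theta> / 3) (r / 2)\<close>. The growth of the threshold pays for the \<open>lam\<close> children.
\<close>

lemma prob_ball_stretch_aux:
  assumes gap: "\<And>x y. x \<in> X \<Longrightarrow> y \<in> X \<Longrightarrow> x \<noteq> y \<Longrightarrow> \<delta> \<le> D x y"
  shows "\<lbrakk>s \<in> X; 0 < r; r < \<delta> * 2 ^ k; 100 \<le> \<theta>\<rbrakk> \<Longrightarrow>
    prob {\<omega> \<in> space M. \<exists>q\<in>X. D s q \<le> r \<and> \<theta> * r < \<rho> \<omega> s q} \<le> exp (- real d * \<theta>)"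
proof (induction k arbitrary: s r \<theta>)
  \<comment> \<open>Here \<open>r < \<delta>\<close>, so the ball consists of \<open>s\<close> alone
    and the event is empty.\<close>
  case 0
  have "\<not> (\<exists>q\<in>X. D s q \<le> r \<and> \<theta> * r < \<rho> \<omega> s q)" if \<omega>: "\<omega> \<in> space M" for \<omega>
  proof
    assume "\<exists>q\<in>X. D s q \<le> r \<and> \<theta> * r < \<rho> \<omega> s q"
    then obtain q where q: "q \<in> X" "D s q \<le> r" "\<theta> * r < \<rho> \<omega> s q" by blast
    interpret P: finite_pseudometric X "\<rho> \<omega>" using rho_pseudometric[OF \<omega>] .
    have "s = q" using gap[of s q] 0 q by fastforce
    then have "\<rho> \<omega> s q = 0" using P.self_zero 0 by simp
    moreover have "0 < \<theta> * r" using 0 by simp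
    ultimately show False using q by simp
  qed
  then have empty: "{\<omega> \<in> space M. \<exists>q\<in>X. D s q \<le> r \<and> \<theta> * r < \<rho> \<omega> s q} = {}" by blast
  show ?case unfolding empty by simp
next
  case (Suc k)
  note s = Suc.prems(1) and r = Suc.prems(2) and th = Suc.prems(4)
  obtain S where S: "S \<subseteq> X" "card S \<le> lam" "\<And>q. q \<in> X \<Longrightarrow> D s q \<le> r \<Longrightarrow> \<exists>t\<in>S. D t q \<le> r / 2"
    using doubling[OF s r] by blast
  \<comment> \<open>A centre within \<open>r / 2\<close> of some point of the ball lies within
    \<open>3 / 2 * r\<close> of \<open>s\<close>. Discarding the others gives an upper bound on
    \<open>D s t\<close>, which the stretch estimate needs.\<close>
  define S' where "S' = {t \<in> S. D s t \<le> 3 / 2 * r}"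
  have S': "S' \<subseteq> X" "finite S'" "card S' \<le> lam"
    using S finite_points card_mono[of S S'] finite_subset[OF S(1)] by (auto simp: S'_def)
  define A where "A t = {\<omega> \<in> space M. \<theta> * r / 3 < \<rho> \<omega> s t}" for t
  define B where "B t = {\<omega> \<in> space M. \<exists>q\<in>X. D t q \<le> r / 2 \<and> (4 / 3 * \<theta>) * (r / 2) < \<rho> \<omega> t q}" for t
  have meas: "A t \<in> events" "B t \<in> events" for t
    using finite_points by (auto simp: A_def B_def)
  \<comment> \<open>The extra 2 in the exponent leaves a factor \<open>exp (- 2 * d)\<close>. It
    absorbs the at most \<open>lam\<close> centres and the factor 2 for the two kinds of
    failure.\<close>
  have pA: "prob (A t) \<le> exp (- real d * (\<theta> + 2))" if t: "t \<in> S'" for t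
  proof -
    have tX: "t \<in> X" using that S'(1) by blast
    have "A t \<subseteq> {\<omega> \<in> space M. (2 / 9 * \<theta>) * D s t < \<rho> \<omega> s t}"
    proof -
      have "(2 / 9 * \<theta>) * D s t \<le> (2 / 9 * \<theta>) * (3 / 2 * r)"
        using t th by (intro mult_left_mono) (auto simp: S'_def)
      then show ?thesis by (auto simp: A_def)
    qed
    then have "prob (A t) \<le> prob {\<omega> \<in> space M. (2 / 9 * \<theta>) * D s t < \<rho> \<omega> s t}"
      by (intro finite_measure_mono) auto
    also have "\<dots> \<le> exp (real d * (1 / 2 - (2 / 9 * \<theta>)\<^sup>2 / 4))"
      using th s tX by (intro stretch) auto
    also have "\<dots> \<le> exp (- real d * (\<theta> + 2))"
    proof -
      \<comment> \<open>The quadratic tail becomes linear here: \<open>\<theta> \<ge> 100\<close>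
        gives \<open>\<theta> * \<theta> / 81 \<ge> 100 / 81 * \<theta>\<close>, which exceeds
        \<open>\<theta> + 5 / 2\<close>.\<close>
      have "100 * \<theta> \<le> \<theta> * \<theta>" using th by (intro mult_right_mono) auto
      moreover have "(2 / 9 * \<theta>)\<^sup>2 / 4 = \<theta> * \<theta> / 81" by (simp add: power2_eq_square)
      ultimately have "1 / 2 - (2 / 9 * \<theta>)\<^sup>2 / 4 \<le> - (\<theta> + 2)" using th by linarith
      then have "real d * (1 / 2 - (2 / 9 * \<theta>)\<^sup>2 / 4) \<le> real d * - (\<theta> + 2)"
        by (rule mult_left_mono) simp
      then show ?thesis by (simp only: exp_le_cancel_iff mult_minus_left mult_minus_right)
    qed
    finally show ?thesis .
  qed
  have pB: "prob (B t) \<le> exp (- real d * (\<theta> + 2))" if "t \<in> S'" for t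
  proof -
    have "prob (B t) \<le> exp (- real d * (4 / 3 * \<theta>))"
      unfolding B_def using Suc.prems that S'(1) by (intro Suc.IH) auto
    also have "\<dots> \<le> exp (- real d * (\<theta> + 2))"
    proof -
      have "real d * (\<theta> + 2) \<le> real d * (4 / 3 * \<theta>)"
        using th by (intro mult_left_mono) auto
      then show ?thesis by (simp only: exp_le_cancel_iff mult_minus_left neg_le_iff_le)
    qed
    finally show ?thesis .
  qed
  have "{\<omega> \<in> space M. \<exists>q\<in>X. D s q \<le> r \<and> \<theta> * r < \<rho> \<omega> s q} \<subseteq> (\<Union>t\<in>S'. A t \<union> B t)"
  proof
    fix \<omega> assume "\<omega> \<in> {\<omega> \<in> space M. \<exists>q\<in>X. D s q \<le> r \<and> \<theta> * r < \<rho> \<omega> s q}"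
    then obtain q where \<omega>: "\<omega> \<in> space M" and q: "q \<in> X" "D s q \<le> r" "\<theta> * r < \<rho> \<omega> s q" by blast
    interpret P: finite_pseudometric X "\<rho> \<omega>" using rho_pseudometric[OF \<omega>] .
    obtain t where t: "t \<in> S" "D t q \<le> r / 2" using S(3) q by blast
    then have tX: "t \<in> X" using S by blast
    have "D s t \<le> D s q + D q t" "D q t = D t q" using triangle commute s q(1) tX by blast+
    then have "t \<in> S'" using t q by (simp add: S'_def)
    moreover have "\<rho> \<omega> s q \<le> \<rho> \<omega> s t + \<rho> \<omega> t q" using P.triangle s q(1) tX by blast
    then have "\<omega> \<in> A t \<union> B t" using q t \<omega> by (auto simp: A_def B_def)
    ultimately show "\<omega> \<in> (\<Union>t\<in>S'. A t \<union> B t)" by blast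
  qed
  then have "prob {\<omega> \<in> space M. \<exists>q\<in>X. D s q \<le> r \<and> \<theta> * r < \<rho> \<omega> s q} \<le> prob (\<Union>t\<in>S'. A t \<union> B t)"
    using meas S'(2) by (intro finite_measure_mono) auto
  also have "\<dots> \<le> (\<Sum>t\<in>S'. prob (A t \<union> B t))"
    using meas S'(2) by (intro finite_measure_subadditive_finite) auto
  also have "\<dots> \<le> (\<Sum>t\<in>S'. 2 * exp (- real d * (\<theta> + 2)))"
  proof (rule sum_mono)
    fix t assume t: "t \<in> S'"
    have "prob (A t \<union> B t) \<le> prob (A t) + prob (B t)"
      by (intro measure_Un_le meas)
    then show "prob (A t \<union> B t) \<le> 2 * exp (- real d * (\<theta> + 2))" using pA[OF t] pB[OF t] by linarith
  qed
  also have "\<dots> \<le> real lam * (2 * exp (- real d * (\<theta> + 2)))"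
    using S'(3) by (simp add: mult_right_mono)
  also have "\<dots> \<le> exp (real d) * (exp (real d) * exp (- real d * (\<theta> + 2)))"
  proof (intro mult_mono lam_le_exp)
    have "2 \<le> exp (1::real)" using exp_ge_add_one_self[of "1::real"] by simp
    also have "\<dots> \<le> exp (real d)" using d_pos by simp
    finally show "2 \<le> exp (real d)" .
  qed auto
  also have "\<dots> = exp (- real d * \<theta>)"
    by (simp add: exp_add[symmetric] algebra_simps)
  finally show ?case .
qed

text \<open>A finite set has a positive minimal gap, so every radius lies below
  \<open>\<delta> * 2 ^ k\<close> for some \<open>k\<close>, and the bound from chaining does not
  depend on \<open>k\<close>.\<close>

lemma prob_ball_stretch:
  assumes "s \<in> X" "0 < r" "100 \<le> \<theta>"
  shows "prob {\<omega> \<in> space M. \<exists>q\<in>X. D s q \<le> r \<and> \<theta> * r < \<rho> \<omega> s q} \<le> exp (- real d * \<theta>)"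
proof -
  define P where "P = {(x, y) \<in> X \<times> X. x \<noteq> y}"
  \<comment> \<open>The inserted 1 keeps the minimum meaningful when \<open>X\<close> is a single
    point.\<close>
  define \<delta> where "\<delta> = Min (insert 1 ((\<lambda>(x, y). D x y) ` P))"
  have finP: "finite P" unfolding P_def by (rule finite_subset[of _ "X \<times> X"]) (auto simp: finite_points)
  have gap: "\<delta> \<le> D x y" if "x \<in> X" "y \<in> X" "x \<noteq> y" for x y
    unfolding \<delta>_def using that finP by (intro Min_le) (auto simp: P_def image_iff)
  have pos: "\<delta> > 0"
    unfolding \<delta>_def using finP dist_pos by (subst Min_gr_iff) (auto simp: P_def)
  obtain k where "r / \<delta> < 2 ^ k" using real_arch_pow[of 2 "r / \<delta>"] by auto
  then have "r < \<delta> * 2 ^ k" using pos by (simp add: field_simps)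
  then show ?thesis using prob_ball_stretch_aux[OF gap] assms by blast
qed

text \<open>
  The annulus \<open>4\<^sup>j r < D x q \<le> 4\<^sup>j\<^sup>+\<^sup>1 r\<close> is covered by \<open>lam ^ (4 j + 22)\<close> balls of radius
  \<open>4\<^sup>-\<^sup>j 2\<^sup>-\<^sup>2\<^sup>0 r\<close>. Using the stretch threshold \<open>100 \<cdot> 4\<^sup>j\<close> on them makes both failure
  probabilities decay fast enough in \<open>j\<close> to beat the number of balls.
\<close>

lemma prob_annulus_collapse:
  assumes x: "x \<in> X" and r: "0 < r"
  shows "prob {\<omega> \<in> space M. \<exists>q\<in>X. 4 ^ j * r < D x q \<and> D x q \<le> 4 ^ Suc j * r \<and> \<rho> \<omega> x q < 100 / 2 ^ 20 * r}
    \<le> (1 / 2) ^ (j + 2)"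
proof -
  define R where "R = r / (4 ^ j * 2 ^ 20)"
  have R: "R > 0" using r by (simp add: R_def)
  have R_le: "R \<le> r * 4 ^ j / 2"
  proof -
    have "1 \<le> (4::real) ^ j" by simp
    then have "1 * 1 \<le> (4::real) ^ j * 4 ^ j" by (rule mult_mono) auto
    then show ?thesis using r by (simp add: R_def field_simps)
  qed
  \<comment> \<open>The permitted stretch of a small ball equals the collapse threshold. Hence the
    centre covering a collapsed point is itself mapped to within twice that threshold, or its ball
    is stretched too much.\<close>
  have Rj: "100 * 4 ^ j * R = 100 / 2 ^ 20 * r" by (simp add: R_def)
  obtain S where S: "S \<subseteq> X" "card S \<le> lam ^ (4 * j + 22)"
     "\<And>q. q \<in> X \<Longrightarrow> D x q \<le> 4 ^ Suc j * r \<Longrightarrow> \<exists>s\<in>S. D s q \<le> 4 ^ Suc j * r / 2 ^ (4 * j + 22)"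
    using iterated_doubling[OF x, of "4 ^ Suc j * r" "4 * j + 22"] r by auto
  have "(2::real) ^ (4 * j + 22) = 4 ^ Suc j * (4 ^ j * 2 ^ 20)"
  proof -
    have "(2::real) ^ (4 * j) = (2 ^ 2) ^ j * (2 ^ 2) ^ j"
      by (simp only: power_mult[symmetric] power_add[symmetric]) (simp add: algebra_simps)
    then show ?thesis by (simp add: power_add)
  qed
  then have SR: "4 ^ Suc j * r / 2 ^ (4 * j + 22) = R"
    by (simp add: R_def)
  \<comment> \<open>As \<open>R \<le> r * 4 ^ j / 2\<close>, a centre covering a point of the
    annulus satisfies this condition. The lower bound on \<open>D x s\<close> is what makes the
    contraction estimate effective.\<close>
  define S' where "S' = {s \<in> S. 4 ^ j * r / 2 \<le> D x s}"
  have S': "S' \<subseteq> X" "finite S'" "card S' \<le> lam ^ (4 * j + 22)"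
    using S finite_points card_mono[of S S'] finite_subset[OF S(1)] by (auto simp: S'_def)
  define A where "A s = {\<omega> \<in> space M. \<rho> \<omega> x s \<le> 200 / 2 ^ 20 * r}" for s
  define B where "B s = {\<omega> \<in> space M. \<exists>q\<in>X. D s q \<le> R \<and> (100 * 4 ^ j) * R < \<rho> \<omega> s q}" for s
  have meas: "A s \<in> events" "B s \<in> events" for s
    using finite_points by (auto simp: A_def B_def)
  let ?p = "((1 / 2) ^ (10 + 2 * j)) ^ d :: real"
  have pA: "prob (A s) \<le> ?p" if s: "s \<in> S'" for s
  proof -
    \<comment> \<open>Chosen so that \<open>t\<close> times the least possible distance
      \<open>4 ^ j * r / 2\<close> is \<open>200 / 2 ^ 20 * r\<close>; then \<open>2 * t\<close> is
      below \<open>1 / (2 ^ 10 * 4 ^ j)\<close> because \<open>800 \<le> 2 ^ 10\<close>.\<close>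
    define t :: real where "t = 400 / (2 ^ 20 * 4 ^ j)"
    have sX: "s \<in> X" using that S'(1) by blast
    have "0 < 4 ^ j * r / 2" using r by simp
    also have "\<dots> \<le> D x s" using s by (simp add: S'_def)
    finally have ne: "x \<noteq> s" using self_zero[OF x] by auto
    have "200 / 2 ^ 20 * r = t * (4 ^ j * r / 2)" by (simp add: t_def)
    also have "\<dots> \<le> t * D x s" using s by (intro mult_left_mono) (auto simp: S'_def t_def)
    finally have "prob (A s) \<le> prob {\<omega> \<in> space M. \<rho> \<omega> x s \<le> t * D x s}"
      unfolding A_def by (intro finite_measure_mono) auto
    also have "\<dots> \<le> (2 * t) ^ d"
      using x sX ne by (intro contract) (auto simp: t_def)
    also have "\<dots> \<le> ?p"
    proof (rule power_mono)
      have "(1 / 2 :: real) ^ (2 * j) = 1 / 4 ^ j"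
        by (simp add: power_mult power_divide)
      then have "(1 / 2 :: real) ^ (10 + 2 * j) = 1 / 2 ^ 10 * (1 / 4 ^ j)"
        by (simp add: power_add power_divide)
      then show "2 * t \<le> (1 / 2) ^ (10 + 2 * j)" by (simp add: t_def field_simps)
    qed (simp add: t_def)
    finally show ?thesis .
  qed
  have pB: "prob (B s) \<le> ?p" if "s \<in> S'" for s
  proof -
    have "prob (B s) \<le> exp (- real d * (100 * 4 ^ j))"
      unfolding B_def using that S'(1) R by (intro prob_ball_stretch) auto
    also have "\<dots> = exp (- (100 * 4 ^ j)) ^ d"
      by (simp add: exp_of_nat_mult[symmetric])
    also have "\<dots> \<le> ?p"
    proof (rule power_mono)
      have j: "real j + 1 \<le> 4 ^ j"
        using Bernoulli_inequality[of "3::real" j] by simp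
      have "exp (- (100 * 4 ^ j)) \<le> exp (- real (10 + 2 * j))" using j by simp
      also have "\<dots> = exp (-1) ^ (10 + 2 * j)" by (simp only: exp_of_nat_mult[symmetric]) simp
      also have "\<dots> \<le> (1 / 2) ^ (10 + 2 * j)"
      proof (rule power_mono)
        have "2 \<le> exp (1::real)" using exp_ge_add_one_self[of "1::real"] by simp
        then show "exp (-1) \<le> (1 / 2 :: real)" by (simp add: exp_minus field_simps)
      qed simp
      finally show "exp (- (100 * 4 ^ j)) \<le> (1 / 2 :: real) ^ (10 + 2 * j)" .
    qed simp
    finally show ?thesis .
  qed
  let ?E = "{\<omega> \<in> space M. \<exists>q\<in>X. 4 ^ j * r < D x q \<and> D x q \<le> 4 ^ Suc j * r \<and> \<rho> \<omega> x q < 100 / 2 ^ 20 * r}"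
  have "?E \<subseteq> (\<Union>s\<in>S'. A s \<union> B s)"
  proof
    fix \<omega> assume "\<omega> \<in> ?E"
    then obtain q where \<omega>: "\<omega> \<in> space M" and q: "q \<in> X" "4 ^ j * r < D x q" "D x q \<le> 4 ^ Suc j * r"
       "\<rho> \<omega> x q < 100 / 2 ^ 20 * r" by blast
    interpret P: finite_pseudometric X "\<rho> \<omega>" using rho_pseudometric[OF \<omega>] .
    obtain s where s: "s \<in> S" "D s q \<le> R" using S(3)[OF q(1,3)] SR by auto
    then have sX: "s \<in> X" using S by blast
    have "D x q \<le> D x s + D s q" using triangle x q(1) sX by blast
    then have "s \<in> S'" using s q R_le by (simp add: S'_def mult.commute)
    moreover have "\<rho> \<omega> x s \<le> \<rho> \<omega> x q + \<rho> \<omega> q s" "\<rho> \<omega> q s = \<rho> \<omega> s q"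
      using P.triangle P.commute x q(1) sX by blast+
    then have "\<rho> \<omega> x s \<le> 200 / 2 ^ 20 * r \<or> 100 * 4 ^ j * R < \<rho> \<omega> s q"
      using q(4) Rj by linarith
    then have "\<omega> \<in> A s \<union> B s" using q(1) s(2) \<omega> by (auto simp: A_def B_def)
    ultimately show "\<omega> \<in> (\<Union>t\<in>S'. A t \<union> B t)" by blast
  qed
  then have "prob ?E \<le> prob (\<Union>s\<in>S'. A s \<union> B s)"
    using meas S'(2) by (intro finite_measure_mono) auto
  also have "\<dots> \<le> (\<Sum>s\<in>S'. prob (A s \<union> B s))"
    using meas S'(2) by (intro finite_measure_subadditive_finite) auto
  also have "\<dots> \<le> (\<Sum>s\<in>S'. 2 * ?p)"
  proof (rule sum_mono)
    fix s assume s: "s \<in> S'"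
    have "prob (A s \<union> B s) \<le> prob (A s) + prob (B s)"
      by (intro measure_Un_le meas)
    then show "prob (A s \<union> B s) \<le> 2 * ?p" using pA[OF s] pB[OF s] by linarith
  qed
  also have "\<dots> \<le> real (lam ^ (4 * j + 22)) * (2 * ?p)"
    using S'(3) by (simp add: mult_right_mono del: of_nat_power)
  \<comment> \<open>Since \<open>4 * j + 22 \<le> 22 * Suc j\<close>, the hypothesis on
    \<open>lam\<close> bounds the number of centres by \<open>(2 ^ d) ^ Suc j\<close>. One more
    \<open>2 ^ d\<close> pays for the two failures per centre, leaving
    \<open>2 ^ (- d * (8 + j))\<close>.\<close>
  also have "\<dots> \<le> (2 ^ d) ^ Suc j * (2 ^ d * ?p)"
  proof (intro mult_mono)
    have "real (lam ^ (4 * j + 22)) \<le> real lam ^ (22 * Suc j)"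
      using lam_pos by (simp only: of_nat_power) (rule power_increasing, auto)
    also have "\<dots> \<le> (2 ^ d) ^ Suc j"
      unfolding power_mult by (rule power_mono[OF lam_le]) simp
    finally show "real (lam ^ (4 * j + 22)) \<le> (2 ^ d) ^ Suc j" .
    show "(2::real) \<le> 2 ^ d" using d_pos self_le_power[of "2::real" d] by simp
  qed auto
  also have "\<dots> = ((1 / 2) ^ (8 + j)) ^ d"
  proof -
    have "(2 ^ d) ^ Suc j * (2 ^ d * ?p) = (2 ^ Suc j * (2 * (1 / 2) ^ (10 + 2 * j))) ^ d"
      by (simp only: power_mult_distrib power_mult[symmetric] mult.commute[of d])
    also have "(2::real) ^ Suc j * (2 * (1 / 2) ^ (10 + 2 * j)) = (1 / 2) ^ (8 + j)"
      by (simp add: power_add power_mult power_divide field_simps,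
          simp add: power2_eq_square power_mult_distrib[symmetric])
    finally show ?thesis .
  qed
  also have "\<dots> \<le> ((1 / 2) ^ (8 + j)) ^ 1"
    using d_pos by (intro power_decreasing) (auto simp: power_le_one)
  also have "\<dots> \<le> (1 / 2) ^ (j + 2)"
    by (simp only: power_one_right) (rule power_decreasing, auto)
  finally show ?thesis .
qed

text \<open>Union bound over the annuli. Finitely many of them reach all of \<open>X\<close>, and
  the geometric series of their probabilities stays below 1/2.\<close>

lemma prob_collapse:
  assumes x: "x \<in> X" and r: "0 < r"
  shows "prob {\<omega> \<in> space M. \<exists>q\<in>X. r < D x q \<and> \<rho> \<omega> x q < 100 / 2 ^ 20 * r} \<le> 1 / 2"
proof -
  define E where "E j = {\<omega> \<in> space M. \<exists>q\<in>X. 4 ^ j * r < D x q \<and> D x q \<le> 4 ^ Suc j * r \<and>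
    \<rho> \<omega> x q < 100 / 2 ^ 20 * r}" for j
  have meas: "E j \<in> events" for j using finite_points by (auto simp: E_def)
  obtain k where k: "(\<Sum>q\<in>X. D x q) / r < 4 ^ k" using real_arch_pow[of 4 "(\<Sum>q\<in>X. D x q) / r"] by auto
  have far: "D x q < 4 ^ k * r" if "q \<in> X" for q
  proof -
    have "D x q \<le> (\<Sum>q\<in>X. D x q)"
      by (rule member_le_sum) (use that x nonneg finite_points in auto)
    then show ?thesis using k r by (simp add: field_simps)
  qed
  have "{\<omega> \<in> space M. \<exists>q\<in>X. r < D x q \<and> \<rho> \<omega> x q < 100 / 2 ^ 20 * r} \<subseteq> (\<Union>j<k. E j)"
  proof
    fix \<omega> assume "\<omega> \<in> {\<omega> \<in> space M. \<exists>q\<in>X. r < D x q \<and> \<rho> \<omega> x q < 100 / 2 ^ 20 * r}"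
    then obtain q where q: "\<omega> \<in> space M" "q \<in> X" "r < D x q" "\<rho> \<omega> x q < 100 / 2 ^ 20 * r" by blast
    \<comment> \<open>The least such exponent is positive because \<open>r < D x q\<close>, so its
      predecessor \<open>j\<close> is the index of the annulus containing \<open>q\<close>.\<close>
    define i where "i = (LEAST i. D x q \<le> 4 ^ i * r)"
    have i: "D x q \<le> 4 ^ i * r" "i \<le> k"
      unfolding i_def using far[OF q(2)] by (auto intro: LeastI Least_le less_imp_le)
    have "i \<noteq> 0" using i q by (intro notI) simp
    then obtain j where j: "i = Suc j" using not0_implies_Suc by blast
    have "4 ^ j * r < D x q"
      using not_less_Least[of j "\<lambda>i. D x q \<le> 4 ^ i * r"] j by (simp add: i_def)
    then have "\<omega> \<in> E j" using q i j by (auto simp: E_def)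
    then show "\<omega> \<in> (\<Union>j<k. E j)" using i j by auto
  qed
  then have "prob {\<omega> \<in> space M. \<exists>q\<in>X. r < D x q \<and> \<rho> \<omega> x q < 100 / 2 ^ 20 * r} \<le> prob (\<Union>j<k. E j)"
    using meas by (intro finite_measure_mono) auto
  also have "\<dots> \<le> (\<Sum>j<k. prob (E j))"
    using meas by (intro finite_measure_subadditive_finite) auto
  also have "\<dots> \<le> (\<Sum>j<k. (1 / 2) ^ (j + 2))"
    unfolding E_def by (intro sum_mono prob_annulus_collapse x r)
  also have "\<dots> \<le> 1 / 2"
  proof -
    have "(\<Sum>j<k. (1 / 2 :: real) ^ (j + 2)) = 1 / 2 - (1 / 2) ^ (k + 1)"
      by (induction k) (auto simp: field_simps)
    then show ?thesis by simp
  qed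
  finally show ?thesis .
qed


section \<open>Expected sum of the projected radii\<close>

lemma prob_nondegenerate:
  assumes "x \<in> X" "r > 0"
  shows "1 / 2 \<le> prob {\<omega> \<in> space M. \<forall>q\<in>X. r < D x q \<longrightarrow> 100 / 2 ^ 20 * r \<le> \<rho> \<omega> x q}"
proof -
  let ?E = "{\<omega> \<in> space M. \<exists>q\<in>X. r < D x q \<and> \<rho> \<omega> x q < 100 / 2 ^ 20 * r}"
  have eq: "{\<omega> \<in> space M. \<forall>q\<in>X. r < D x q \<longrightarrow> 100 / 2 ^ 20 * r \<le> \<rho> \<omega> x q} = space M - ?E"
    by (auto simp: not_less)
  have "?E \<in> events" using finite_points by auto
  then have "prob (space M - ?E) = 1 - prob ?E" by (rule prob_compl)
  then show ?thesis unfolding eq using prob_collapse[OF assms] by linarith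
qed

text \<open>At radius \<open>?s\<close> around \<open>x\<close> the far points contribute no
  projected mass. Each remaining point contributes at most \<open>?s \<le> ?r / 2\<close>, and by
  \<open>card_half_ball\<close> they total at most 1, however close they are mapped.\<close>

lemma mp_radius_rho_ge:
  assumes \<omega>: "\<omega> \<in> space M" and x: "x \<in> X"
    and far: "\<And>q. q \<in> X \<Longrightarrow> mp_radius D X x / 2 < D x q \<Longrightarrow> 100 / 2 ^ 20 * (mp_radius D X x / 2) \<le> \<rho> \<omega> x q"
  shows "100 / 2 ^ 20 * (mp_radius D X x / 2) \<le> mp_radius (\<rho> \<omega>) X x"
proof -
  interpret P: finite_pseudometric X "\<rho> \<omega>" using rho_pseudometric[OF \<omega>] .
  let ?r = "mp_radius D X x" and ?s = "100 / 2 ^ 20 * (mp_radius D X x / 2)"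
  note r = mp_radius_pos[OF x]
  have "ball_mass (\<rho> \<omega>) X x ?s = (\<Sum>q\<in>{q \<in> X. D x q \<le> ?r / 2}. max 0 (?s - \<rho> \<omega> x q))"
    unfolding ball_mass_def
  proof (rule sum.mono_neutral_right[OF finite_points])
    show "\<forall>q\<in>X - {q \<in> X. D x q \<le> ?r / 2}. max 0 (?s - \<rho> \<omega> x q) = 0"
    proof
      fix q assume "q \<in> X - {q \<in> X. D x q \<le> ?r / 2}"
      then have "?s \<le> \<rho> \<omega> x q" using far[of q] by (auto simp: not_le)
      then show "max 0 (?s - \<rho> \<omega> x q) = 0" by linarith
    qed
  qed blast
  also have "\<dots> \<le> (\<Sum>q\<in>{q \<in> X. D x q \<le> ?r / 2}. ?r / 2)"
  proof (rule sum_mono)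
    fix q assume "q \<in> {q \<in> X. D x q \<le> ?r / 2}"
    then show "max 0 (?s - \<rho> \<omega> x q) \<le> ?r / 2" using P.nonneg[OF x, of q] r by (auto simp: max_def)
  qed
  also have "\<dots> \<le> 1" using card_half_ball[OF x] by simp
  finally show ?thesis by (rule P.mp_radius_geI[OF x])
qed

text \<open>The minorant \<open>g\<close> is a finite combination of indicators of the good events,
  so measurability of the random radii never enters. The constant is \<open>100 / 2 ^ 20\<close>,
  halved once for the radius \<open>?r x / 2\<close> and once for the probability of
  \<open>A x\<close>.\<close>

lemma expectation_ge_sum_mp_radius:
  assumes h: "integrable M h" and le: "AE \<omega> in M. (\<Sum>x\<in>X. mp_radius (\<rho> \<omega>) X x) \<le> h \<omega>"
  shows "100 / 2 ^ 22 * (\<Sum>x\<in>X. mp_radius D X x) \<le> expectation h"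
proof -
  let ?r = "mp_radius D X"
  define A where "A x = {\<omega> \<in> space M. \<forall>q\<in>X. ?r x / 2 < D x q \<longrightarrow> 100 / 2 ^ 20 * (?r x / 2) \<le> \<rho> \<omega> x q}" for x
  have meas: "A x \<in> events" for x using finite_points by (auto simp: A_def)
  define g where "g \<omega> = (\<Sum>x\<in>X. 100 / 2 ^ 20 * (?r x / 2) * indicat_real (A x) \<omega>)" for \<omega>
  have int: "integrable M (\<lambda>\<omega>. 100 / 2 ^ 20 * (?r x / 2) * indicat_real (A x) \<omega>)" for x
    using meas by (intro integrable_mult_right integrable_real_indicator) (auto simp: emeasure_eq_measure)
  have "100 / 2 ^ 22 * (\<Sum>x\<in>X. ?r x) = (\<Sum>x\<in>X. 100 / 2 ^ 20 * (?r x / 2) * (1 / 2))"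
    by (simp add: sum_distrib_left)
  also have "\<dots> \<le> (\<Sum>x\<in>X. 100 / 2 ^ 20 * (?r x / 2) * prob (A x))"
  proof (intro sum_mono mult_left_mono)
    fix x assume x: "x \<in> X"
    show "1 / 2 \<le> prob (A x)"
      unfolding A_def using prob_nondegenerate[OF x, of "?r x / 2"] mp_radius_pos[OF x] by simp
    show "0 \<le> 100 / 2 ^ 20 * (?r x / 2)" using mp_radius_pos[OF x] by simp
  qed
  also have "\<dots> = expectation g"
    unfolding g_def using int meas by (subst Bochner_Integration.integral_sum) (auto simp: Int_absorb2 sets.sets_into_space)
  also have "\<dots> \<le> expectation h"
  proof (rule integral_mono_AE[OF _ h])
    show "integrable M g" unfolding g_def using int by (rule Bochner_Integration.integrable_sum)
    show "AE \<omega> in M. g \<omega> \<le> h \<omega>"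
      using le
    proof (rule AE_mp, intro AE_I2 impI)
      fix \<omega> assume \<omega>: "\<omega> \<in> space M" and le: "(\<Sum>x\<in>X. mp_radius (\<rho> \<omega>) X x) \<le> h \<omega>"
      interpret P: finite_pseudometric X "\<rho> \<omega>" using rho_pseudometric[OF \<omega>] .
      have "g \<omega> \<le> (\<Sum>x\<in>X. mp_radius (\<rho> \<omega>) X x)"
        unfolding g_def
      proof (rule sum_mono)
        fix x assume x: "x \<in> X"
        show "100 / 2 ^ 20 * (?r x / 2) * indicat_real (A x) \<omega> \<le> mp_radius (\<rho> \<omega>) X x"
        proof (cases "\<omega> \<in> A x")
          case True
          then have "100 / 2 ^ 20 * (?r x / 2) \<le> mp_radius (\<rho> \<omega>) X x"
            by (intro mp_radius_rho_ge[OF \<omega> x]) (simp add: A_def)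
          then show ?thesis using True by simp
        qed (use P.mp_radius_pos[OF x] in simp)
      qed
      then show "g \<omega> \<le> h \<omega>" using le by simp
    qed
  qed
  finally show ?thesis .
qed

text \<open>Let \<open>t\<close> tend to 0 in the contraction bound. This yields almost sure
  injectivity of the projection on \<open>X\<close>.\<close>

lemma AE_rho_pos: "AE \<omega> in M. \<forall>x\<in>X. \<forall>y\<in>X. x \<noteq> y \<longrightarrow> 0 < \<rho> \<omega> x y"
proof -
  have "AE \<omega> in M. 0 < \<rho> \<omega> x y" if xy: "x \<in> X" "y \<in> X" "x \<noteq> y" for x y
  proof -
    let ?Z = "{\<omega> \<in> space M. \<rho> \<omega> x y \<le> 0}"
    have "prob ?Z \<le> 0 + e" if "0 < e" for e
    proof -
      define t where "t = min e 1 / 2"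
      have t: "0 < t" "2 * t \<le> 1" "2 * t \<le> e" using that by (auto simp: t_def)
      have "0 \<le> t * D x y" using t nonneg xy by simp
      then have "prob ?Z \<le> prob {\<omega> \<in> space M. \<rho> \<omega> x y \<le> t * D x y}"
        by (intro finite_measure_mono) auto
      also have "\<dots> \<le> (2 * t) ^ d" by (rule contract[OF t(1) xy])
      also have "\<dots> \<le> (2 * t) ^ 1" using t d_pos by (intro power_decreasing) auto
      finally show ?thesis using t by simp
    qed
    then have "prob ?Z \<le> 0" by (rule field_le_epsilon)
    then have "prob ?Z = 0" by (simp add: measure_le_0_iff)
    then have "AE \<omega> in M. \<omega> \<notin> ?Z" by (intro AE_not_in) (simp add: null_setsI emeasure_eq_measure)
    then show ?thesis by (rule AE_mp) (auto intro!: AE_I2)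
  qed
  then show ?thesis by (intro AE_finite_allI[OF finite_points]) (auto simp: AE_all_countable)
qed

end

section \<open>Facility location after projection\<close>

text \<open>The identity as \<open>f\<close> gives the original metric, a projection gives its
  pullback.\<close>

lemma finite_pseudometric_euclid_dist:
  assumes "finite X"
  shows "finite_pseudometric X (\<lambda>x y. euclid_dist n (f x) (f y))"
proof unfold_locales
  fix x y z
  show "euclid_dist n (f x) (f y) = euclid_dist n (f y) (f x)"
    by (simp add: euclid_dist_def L2_set_def power2_commute)
  show "euclid_dist n (f x) (f z) \<le> euclid_dist n (f x) (f y) + euclid_dist n (f y) (f z)"
    using L2_set_triangle_ineq[of "\<lambda>i. f x i - f y i" "\<lambda>i. f y i - f z i" "{..<n}"]
    by (simp add: euclid_dist_def)
qed (use assms in \<open>auto simp: euclid_dist_def L2_set_def sum_nonneg\<close>)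

text \<open>The least number in the definition is attained: taking \<open>S = X\<close> shows that
  \<open>card X\<close> is admissible.\<close>

lemma doubling_const_cover:
  assumes "finite X" "x \<in> X" "0 < r"
  shows "\<exists>S\<subseteq>X. finite S \<and> card S \<le> doubling_const n X \<and>
    ball_in n X x r \<subseteq> (\<Union>s\<in>S. ball_in n X s (r / 2))"
proof -
  have "\<forall>x\<in>X. \<forall>r>0. \<exists>S\<subseteq>X. finite S \<and> card S \<le> card X \<and>
        ball_in n X x r \<subseteq> (\<Union>s\<in>S. ball_in n X s (r / 2))"
  proof (intro ballI allI impI exI[of _ X] conjI)
    fix x and r :: real assume "0 < r"
    then show "ball_in n X x r \<subseteq> (\<Union>s\<in>X. ball_in n X s (r / 2))"
      by (auto simp: ball_in_def euclid_dist_def L2_set_def)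
  qed (use assms in auto)
  from LeastI[of "\<lambda>k. \<forall>x\<in>X. \<forall>r>0. \<exists>S\<subseteq>X. finite S \<and> card S \<le> k \<and>
        ball_in n X x r \<subseteq> (\<Union>s\<in>S. ball_in n X s (r / 2))", OF this]
  show ?thesis unfolding doubling_const_def[symmetric] using assms(2,3) by blast
qed

lemma doubling_const_pos:
  assumes "finite X" "X \<noteq> {}"
  shows "1 \<le> doubling_const n X"
proof -
  obtain x where x: "x \<in> X" using assms by blast
  obtain S where S: "finite S" "card S \<le> doubling_const n X"
      "ball_in n X x 1 \<subseteq> (\<Union>s\<in>S. ball_in n X s (1 / 2))"
    using doubling_const_cover[OF assms(1) x, of 1 n] by auto
  have "x \<in> ball_in n X x 1" using x by (simp add: ball_in_def euclid_dist_def L2_set_def)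
  then have "S \<noteq> {}" using S(3) by blast
  then have "0 < card S" using S(1) by (simp add: card_gt_0_iff)
  then show ?thesis using S(2) by simp
qed

lemma doubling_const_power_le:
  assumes "finite X" "X \<noteq> {}" "22 * doubling_dim n X \<le> real d"
  shows "real (doubling_const n X) ^ 22 \<le> 2 ^ d"
proof -
  have pos: "0 < real (doubling_const n X)" using doubling_const_pos[OF assms(1,2), of n] by simp
  have "real (doubling_const n X) ^ 22 = 2 powr (22 * doubling_dim n X)"
    using pos by (simp add: doubling_dim_def powr_powr[symmetric] mult.commute[of 22] powr_numeral del: powr_powr)
  also have "\<dots> \<le> 2 powr real d" using assms(3) by simp
  finally show ?thesis by (simp add: powr_realpow)
qed

section \<open>The Gaussian projection as a random pseudometric\<close>

lemma mat_apply_diff: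
  "mat_apply d m G x i - mat_apply d m G y i = mat_apply d m G (\<lambda>j. x j - y j) i"
  by (simp add: mat_apply_def sum_subtractf right_diff_distrib)

lemma euclid_dist_mat_apply:
  "euclid_dist d (mat_apply d m G x) (mat_apply d m G y) =
    L2_set (mat_apply d m G (\<lambda>j. x j - y j)) {..<d}"
  by (simp add: euclid_dist_def mat_apply_diff)

text \<open>Points of the carrier vanish from index \<open>n\<close> on, so a coordinate in which
  they differ enters the distance.\<close>

lemma euclid_dist_pos:
  assumes "x \<in> topspace (Euclidean_space n)" "y \<in> topspace (Euclidean_space n)" "x \<noteq> y"
  shows "0 < euclid_dist n x y"
proof -
  obtain i where i: "x i \<noteq> y i" using assms(3) by blast
  then have "i < n" using assms(1,2) by (auto simp: topspace_Euclidean_space not_le[symmetric])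
  then have "euclid_dist n x y \<noteq> 0" using i by (auto simp: euclid_dist_def L2_set_eq_0_iff)
  then show ?thesis by (simp add: euclid_dist_def order_less_le)
qed

lemma random_pseudometric_gaussian:
  assumes X: "X \<subseteq> topspace (Euclidean_space m)" "finite X" "X \<noteq> {}"
    and d: "d \<ge> 1" "22 * doubling_dim m X \<le> real d"
  shows "random_pseudometric (gaussian_matrix d m) X (euclid_dist m)
    (\<lambda>G x y. euclid_dist d (mat_apply d m G x) (mat_apply d m G y)) d (doubling_const m X)"
proof -
  interpret G: gaussian_projection d m using d(1) by unfold_locales
  interpret finite_pseudometric X "euclid_dist m"
    using finite_pseudometric_euclid_dist[OF X(2), of m "\<lambda>x. x"] .
  show ?thesis
  proof (intro random_pseudometric.intro random_pseudometric_axioms.intro)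
    fix x y :: "nat \<Rightarrow> real" and t r :: real and G :: "nat \<times> nat \<Rightarrow> real"
    show "finite_pseudometric X (\<lambda>x y. euclid_dist d (mat_apply d m G x) (mat_apply d m G y))"
      by (rule finite_pseudometric_euclid_dist[OF X(2)])
    show "(\<lambda>G. euclid_dist d (mat_apply d m G x) (mat_apply d m G y)) \<in> borel_measurable (gaussian_matrix d m)"
      unfolding euclid_dist_mat_apply by measurable
    show "G.prob {G \<in> space (gaussian_matrix d m). t * euclid_dist m x y <
        euclid_dist d (mat_apply d m G x) (mat_apply d m G y)} \<le> exp (real d * (1 / 2 - t\<^sup>2 / 4))" if "0 \<le> t"
      unfolding euclid_dist_mat_apply using G.prob_stretch[OF that, of "\<lambda>j. x j - y j"]
      by (simp add: euclid_dist_def)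
    show pos: "0 < euclid_dist m x y" if "x \<in> X" "y \<in> X" "x \<noteq> y"
      using euclid_dist_pos X(1) that by blast
    show "G.prob {G \<in> space (gaussian_matrix d m). euclid_dist d (mat_apply d m G x) (mat_apply d m G y)
       \<le> t * euclid_dist m x y} \<le> (2 * t) ^ d" if "0 < t" "x \<in> X" "y \<in> X" "x \<noteq> y"
      unfolding euclid_dist_mat_apply using G.prob_contract[OF that(1), of "\<lambda>j. x j - y j"] pos[OF that(2-4)]
      by (simp add: euclid_dist_def)
    show "\<exists>S\<subseteq>X. card S \<le> doubling_const m X \<and>
        (\<forall>q\<in>X. euclid_dist m x q \<le> r \<longrightarrow> (\<exists>s\<in>S. euclid_dist m s q \<le> r / 2))" if x: "x \<in> X" and r: "0 < r"
    proof -
      obtain S where S: "S \<subseteq> X" "card S \<le> doubling_const m X"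
          "ball_in m X x r \<subseteq> (\<Union>s\<in>S. ball_in m X s (r / 2))"
        using doubling_const_cover[OF X(2) x r] by blast
      have "\<exists>s\<in>S. euclid_dist m s q \<le> r / 2" if "q \<in> X" "euclid_dist m x q \<le> r" for q
        using subsetD[OF S(3), of q] that by (auto simp: ball_in_def)
      then show ?thesis using S(1,2) by blast
    qed
    show "real (doubling_const m X) ^ 22 \<le> 2 ^ d"
      by (rule doubling_const_power_le[OF X(2,3) d(2)])
    show "1 \<le> doubling_const m X"
      by (rule doubling_const_pos[OF X(2,3)])
  qed (rule d(1) G.prob_space_axioms finite_pseudometric_axioms)+
qed

text \<open>Each value is spread evenly over its fibre. Writing the fibre size as a sum of
  indicators makes its measurability in a random \<open>f\<close> accessible.\<close>

lemma sum_image_multiplicity: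
  fixes g :: "'b \<Rightarrow> real"
  assumes "finite A"
  shows "(\<Sum>y\<in>f ` A. g y) = (\<Sum>x\<in>A. g (f x) / (\<Sum>x'\<in>A. if f x' = f x then 1 else 0))"
proof -
  have card: "(\<Sum>x'\<in>A. if f x' = y then 1 else 0) = real (card {x \<in> A. f x = y})" for y
    using assms by (simp add: sum.If_cases Int_def)
  have "(\<Sum>x\<in>A. g (f x) / (\<Sum>x'\<in>A. if f x' = f x then 1 else 0)) =
     (\<Sum>y\<in>f ` A. \<Sum>x\<in>{x \<in> A. f x = y}. g (f x) / (\<Sum>x'\<in>A. if f x' = f x then 1 else 0))"
    by (rule sum.image_gen[OF assms])
  also have "\<dots> = (\<Sum>y\<in>f ` A. \<Sum>x\<in>{x \<in> A. f x = y}. g y / real (card {x \<in> A. f x = y}))"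
    by (intro sum.cong) (auto simp: card)
  also have "\<dots> = (\<Sum>y\<in>f ` A. g y)"
  proof (rule sum.cong[OF refl])
    fix y assume "y \<in> f ` A"
    then have "card {x \<in> A. f x = y} \<noteq> 0" using assms by auto
    then show "(\<Sum>x\<in>{x \<in> A. f x = y}. g y / real (card {x \<in> A. f x = y})) = g y" by simp
  qed
  finally show ?thesis ..
qed

text \<open>
  On the null set where \<open>G\<close> is not injective on \<open>X\<close>, the dataset \<open>G X\<close> has fewer points than \<open>X\<close>;
  weighting by multiplicities gives an expression of the cost which is measurable also there.
\<close>

lemma measurable_fl_cost_mat_apply:
  assumes "finite X" "S \<subseteq> X" "S \<noteq> {}"
  shows "(\<lambda>G. fl_cost d (mat_apply d m G ` X) (mat_apply d m G ` S)) \<in> borel_measurable (gaussian_matrix d m)"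
proof -
  have S: "finite S" using assms finite_subset by blast
  have eq: "fl_cost d (mat_apply d m G ` X) (mat_apply d m G ` S) =
     (\<Sum>x\<in>S. 1 / (\<Sum>x'\<in>S. if mat_apply d m G x' = mat_apply d m G x then 1 else 0)) +
     (\<Sum>x\<in>X. Min ((\<lambda>f. L2_set (mat_apply d m G (\<lambda>j. x j - f j)) {..<d}) ` S) /
        (\<Sum>x'\<in>X. if mat_apply d m G x' = mat_apply d m G x then 1 else 0))" for G
  proof -
    have "real (card (mat_apply d m G ` S)) =
        (\<Sum>x\<in>S. 1 / (\<Sum>x'\<in>S. if mat_apply d m G x' = mat_apply d m G x then 1 else 0))"
      using sum_image_multiplicity[OF S, of "\<lambda>_. 1" "mat_apply d m G"] by simp
    then show ?thesis
      unfolding fl_cost_def sum_image_multiplicity[OF assms(1), of _ "mat_apply d m G"]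
      by (simp only: image_image euclid_dist_mat_apply)
  qed
  \<comment> \<open>Both images vanish from index \<open>d\<close> on, so their equality is a finite
    conjunction of equalities of measurable coordinates.\<close>
  have same: "{G \<in> space (gaussian_matrix d m). mat_apply d m G x = mat_apply d m G y} \<in> sets (gaussian_matrix d m)" for x y
  proof -
    have "mat_apply d m G x = mat_apply d m G y \<longleftrightarrow> (\<forall>i<d. mat_apply d m G x i = mat_apply d m G y i)" for G
      by (auto simp: fun_eq_iff mat_apply_def)
    then have "{G \<in> space (gaussian_matrix d m). mat_apply d m G x = mat_apply d m G y} =
      {G \<in> space (gaussian_matrix d m). \<forall>i\<in>{..<d}. mat_apply d m G x i = mat_apply d m G y i}" by blast
    also have "\<dots> \<in> sets (gaussian_matrix d m)"
      by (intro sets.sets_Collect_finite_All borel_measurable_eq measurable_mat_apply) auto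
    finally show ?thesis .
  qed
  show ?thesis
    unfolding eq
    by (intro borel_measurable_add borel_measurable_sum borel_measurable_divide borel_measurable_const
        borel_measurable_Min measurable_If same S assms
        measurable_L2_mat_apply)
qed

lemma fl_cost_image:
  assumes "inj_on f X" "S \<subseteq> X"
  shows "fl_cost n (f ` X) (f ` S) = pm_cost (\<lambda>x y. euclid_dist n (f x) (f y)) X S"
  using assms inj_on_subset[OF assms]
  by (simp add: fl_cost_def pm_cost_def card_image sum.reindex image_image)

text \<open>Merging points can only lower the number of facilities and the connection cost, so the
  estimate covers degenerate matrices as well.\<close>

lemma fl_cost_image_le:
  assumes "finite X" "S \<subseteq> X" "S \<noteq> {}"
  shows "fl_cost n (f ` X) (f ` S) \<le> pm_cost (\<lambda>x y. euclid_dist n (f x) (f y)) X S"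
proof -
  have S: "finite S" using assms finite_subset by blast
  have "(\<Sum>y\<in>f ` X. Min (euclid_dist n y ` f ` S)) \<le> (\<Sum>x\<in>X. Min (euclid_dist n (f x) ` f ` S))"
    using S assms by (intro sum_image_le[unfolded o_def]) (auto simp: euclid_dist_def)
  then show ?thesis using card_image_le[OF S, of f]
    by (simp add: fl_cost_def pm_cost_def image_image)
qed

section \<open>Two-sided bound on the expected projected cost\<close>

locale projected_facility_location =
  fixes m d :: nat and X Fm :: "(nat \<Rightarrow> real) set" and Fd :: "(nat \<times> nat \<Rightarrow> real) \<Rightarrow> (nat \<Rightarrow> real) set"
  assumes X: "X \<subseteq> topspace (Euclidean_space m)" "finite X" "X \<noteq> {}"
    and d: "d \<ge> 1" "22 * doubling_dim m X \<le> real d"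
    and Fm: "fl_optimal m X Fm"
    and Fd: "\<And>G. G \<in> space (gaussian_matrix d m) \<Longrightarrow> fl_optimal d (mat_apply d m G ` X) (Fd G)"
begin

abbreviation \<rho> :: "(nat \<times> nat \<Rightarrow> real) \<Rightarrow> (nat \<Rightarrow> real) \<Rightarrow> (nat \<Rightarrow> real) \<Rightarrow> real" where
  "\<rho> G x y \<equiv> euclid_dist d (mat_apply d m G x) (mat_apply d m G y)"

abbreviation proj_cost :: "(nat \<times> nat \<Rightarrow> real) \<Rightarrow> real" where
  "proj_cost G \<equiv> fl_cost d (mat_apply d m G ` X) (Fd G)"

sublocale G: gaussian_projection d m
  using d(1) by unfold_locales

sublocale random_pseudometric "gaussian_matrix d m" X "euclid_dist m" \<rho> d "doubling_const m X"
  using random_pseudometric_gaussian[OF X d] .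

lemma finite_Fm: "finite Fm" and Fm_subset: "Fm \<subseteq> X" and Fm_nonempty: "Fm \<noteq> {}"
  using Fm X(2) finite_subset by (auto simp: fl_optimal_def fl_solution_def)

lemma Fd_image:
  assumes "G \<in> space (gaussian_matrix d m)"
  obtains S where "S \<subseteq> X" "S \<noteq> {}" "Fd G = mat_apply d m G ` S"
  using Fd[OF assms] unfolding fl_optimal_def fl_solution_def subset_image_iff by auto

lemma proj_cost_le:
  assumes "G \<in> space (gaussian_matrix d m)" "S \<subseteq> X" "S \<noteq> {}"
  shows "proj_cost G \<le> fl_cost d (mat_apply d m G ` X) (mat_apply d m G ` S)"
proof -
  have "fl_solution (mat_apply d m G ` X) (mat_apply d m G ` S)"
    using assms(2,3) by (auto simp: fl_solution_def)
  then show ?thesis using Fd[OF assms(1)] by (simp add: fl_optimal_def)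
qed

text \<open>\<open>Fd\<close> is an arbitrary selection of optimal solutions, but its cost is the
  minimum of finitely many measurable functions, one for each nonempty subset of
  \<open>X\<close>.\<close>

lemma measurable_proj_cost: "proj_cost \<in> borel_measurable (gaussian_matrix d m)"
proof -
  let ?c = "\<lambda>S G. fl_cost d (mat_apply d m G ` X) (mat_apply d m G ` S)"
  have "(\<lambda>G. Min ((\<lambda>S. ?c S G) ` (Pow X - {{}}))) \<in> borel_measurable (gaussian_matrix d m)"
    using X by (intro borel_measurable_Min measurable_fl_cost_mat_apply) auto
  moreover have "Min ((\<lambda>S. ?c S G) ` (Pow X - {{}})) = proj_cost G"
    if G: "G \<in> space (gaussian_matrix d m)" for G
  proof (rule Min_eqI)
    obtain S where "S \<subseteq> X" "S \<noteq> {}" "Fd G = mat_apply d m G ` S" by (rule Fd_image[OF G])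
    then show "proj_cost G \<in> (\<lambda>S. ?c S G) ` (Pow X - {{}})" by auto
  qed (use X(2) proj_cost_le[OF G] in auto)
  ultimately show ?thesis by (simp cong: measurable_cong)
qed

lemma proj_cost_nonneg:
  assumes "G \<in> space (gaussian_matrix d m)"
  shows "0 \<le> proj_cost G"
proof -
  obtain S where S: "S \<subseteq> X" "S \<noteq> {}" "Fd G = mat_apply d m G ` S" by (rule Fd_image[OF assms])
  then have "finite (Fd G)" "Fd G \<noteq> {}" using finite_subset[OF S(1) X(2)] by auto
  then show ?thesis unfolding fl_cost_def
    by (intro add_nonneg_nonneg sum_nonneg) (auto simp: euclid_dist_def)
qed

text \<open>The projected facilities of \<open>Fm\<close> form a candidate solution. Keeping every
  point connected to its old facility \<open>n x\<close> gives the integrable majorant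
  \<open>h\<close>, and distances do not grow in expectation.\<close>

lemma
  shows integrable_proj_cost: "integrable (gaussian_matrix d m) proj_cost"
    and expectation_proj_cost_le: "G.expectation proj_cost \<le> fl_cost m X Fm"
proof -
  have "\<exists>f\<in>Fm. euclid_dist m x f = Min (euclid_dist m x ` Fm)" for x
  proof -
    have "Min (euclid_dist m x ` Fm) \<in> euclid_dist m x ` Fm"
      using finite_Fm Fm_nonempty by (intro Min_in) auto
    then show ?thesis by (metis imageE)
  qed
  then obtain n where n: "\<And>x. n x \<in> Fm" "\<And>x. euclid_dist m x (n x) = Min (euclid_dist m x ` Fm)"
    by metis
  define h where "h G = real (card Fm) + (\<Sum>x\<in>X. \<rho> G x (n x))" for G
  have le: "proj_cost G \<le> h G" if "G \<in> space (gaussian_matrix d m)" for G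
  proof -
    have "proj_cost G \<le> fl_cost d (mat_apply d m G ` X) (mat_apply d m G ` Fm)"
      by (rule proj_cost_le[OF that Fm_subset Fm_nonempty])
    also have "\<dots> \<le> pm_cost (\<rho> G) X Fm"
      by (rule fl_cost_image_le[OF X(2) Fm_subset Fm_nonempty])
    also have "\<dots> \<le> h G"
      unfolding pm_cost_def h_def using n(1) finite_Fm by (intro add_left_mono sum_mono Min_le) auto
    finally show ?thesis .
  qed
  have rho: "integrable (gaussian_matrix d m) (\<lambda>G. \<rho> G x y)" "G.expectation (\<lambda>G. \<rho> G x y) \<le> euclid_dist m x y" for x y
    unfolding euclid_dist_mat_apply
    using G.integrable_L2_mat_apply[of "\<lambda>j. x j - y j"] G.expectation_L2_mat_apply[of "\<lambda>j. x j - y j"]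
    by (auto simp: euclid_dist_def)
  have h: "integrable (gaussian_matrix d m) h"
    unfolding h_def using rho by (intro Bochner_Integration.integrable_add Bochner_Integration.integrable_sum) auto
  show int: "integrable (gaussian_matrix d m) proj_cost"
  proof (rule Bochner_Integration.integrable_bound[OF h measurable_proj_cost], rule AE_I2)
    fix G assume "G \<in> space (gaussian_matrix d m)"
    then show "norm (proj_cost G) \<le> norm (h G)"
      using le[of G] proj_cost_nonneg[of G] by simp
  qed
  have "G.expectation proj_cost \<le> G.expectation h"
    using int h le by (rule integral_mono)
  also have "\<dots> = real (card Fm) + (\<Sum>x\<in>X. G.expectation (\<lambda>G. \<rho> G x (n x)))"
    unfolding h_def using rho by (simp add: G.prob_space)
  also have "\<dots> \<le> real (card Fm) + (\<Sum>x\<in>X. euclid_dist m x (n x))"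
    using rho by (intro add_left_mono sum_mono) auto
  also have "\<dots> = fl_cost m X Fm" by (simp add: n fl_cost_def)
  finally show "G.expectation proj_cost \<le> fl_cost m X Fm" .
qed

text \<open>Where \<open>G\<close> is injective on \<open>X\<close>, the projected radii sum to at
  most twice the projected cost, while the original cost is at most three times the sum of the
  original radii. Dividing \<open>100 / 2 ^ 22\<close> by these factors 2 and 3 gives the
  constant.\<close>

lemma expectation_proj_cost_ge: "100 / 2 ^ 23 / 3 * fl_cost m X Fm \<le> G.expectation proj_cost"
proof -
  have "AE G in gaussian_matrix d m. (\<Sum>x\<in>X. mp_radius (\<rho> G) X x) \<le> 2 * proj_cost G"
    using AE_rho_pos
  proof (rule AE_mp, intro AE_I2 impI)
    fix G assume G: "G \<in> space (gaussian_matrix d m)"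
      and pos: "\<forall>x\<in>X. \<forall>y\<in>X. x \<noteq> y \<longrightarrow> 0 < \<rho> G x y"
    interpret P: finite_pseudometric X "\<rho> G" using rho_pseudometric[OF G] .
    have "inj_on (mat_apply d m G) X"
    proof (rule inj_onI, rule ccontr)
      fix x y assume xy: "x \<in> X" "y \<in> X" "mat_apply d m G x = mat_apply d m G y" "x \<noteq> y"
      then have "0 < \<rho> G x y" using pos by blast
      then show False by (simp add: xy(3) P.self_zero[OF xy(2)])
    qed
    moreover obtain S where "S \<subseteq> X" "S \<noteq> {}" "Fd G = mat_apply d m G ` S" by (rule Fd_image[OF G])
    ultimately show "(\<Sum>x\<in>X. mp_radius (\<rho> G) X x) \<le> 2 * proj_cost G"
      using P.sum_mp_radius_le_cost[of S] by (simp add: fl_cost_image)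
  qed
  then have "100 / 2 ^ 22 * (\<Sum>x\<in>X. mp_radius (euclid_dist m) X x) \<le> G.expectation (\<lambda>G. 2 * proj_cost G)"
    using integrable_proj_cost by (intro expectation_ge_sum_mp_radius) auto
  moreover have "fl_cost m X Fm \<le> 3 * (\<Sum>x\<in>X. mp_radius (euclid_dist m) X x)"
  proof -
    obtain F where F: "F \<noteq> {}" "F \<subseteq> X" "pm_cost (euclid_dist m) X F \<le> 3 * (\<Sum>x\<in>X. mp_radius (euclid_dist m) X x)"
      using ex_cost_le_sum_mp_radius[OF X(3)] by auto
    have "fl_cost m X Fm \<le> fl_cost m X F" using Fm F by (simp add: fl_optimal_def fl_solution_def)
    then show ?thesis using F by (simp add: fl_cost_def pm_cost_def)
  qed
  ultimately show ?thesis by simp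
qed

end

theorem theorem4p1:
  shows "\<exists>C0 c C :: real. C0 > 0 \<and> c > 0 \<and> C > 0 \<and>
    (\<forall>(m :: nat) (d :: nat) (X :: (nat \<Rightarrow> real) set) (Fm :: (nat \<Rightarrow> real) set)
       (Fd :: (nat \<times> nat \<Rightarrow> real) \<Rightarrow> (nat \<Rightarrow> real) set).
       X \<subseteq> topspace (Euclidean_space m) \<longrightarrow> finite X \<longrightarrow> X \<noteq> {} \<longrightarrow>
       d \<ge> 1 \<longrightarrow> real d \<ge> C0 * doubling_dim m X \<longrightarrow>
       fl_optimal m X Fm \<longrightarrow>
       (\<forall>G \<in> space (gaussian_matrix d m). fl_optimal d (mat_apply d m G ` X) (Fd G)) \<longrightarrow>
       integrable (gaussian_matrix d m) (\<lambda>G. fl_cost d (mat_apply d m G ` X) (Fd G)) \<and>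
       c * fl_cost m X Fm
         \<le> (\<integral>G. fl_cost d (mat_apply d m G ` X) (Fd G) \<partial>gaussian_matrix d m) \<and>
       (\<integral>G. fl_cost d (mat_apply d m G ` X) (Fd G) \<partial>gaussian_matrix d m)
         \<le> C * fl_cost m X Fm)"
proof (rule exI[of _ 22], rule exI[of _ "100 / 2 ^ 23 / 3"], rule exI[of _ 1], intro conjI allI impI)
  \<comment> \<open>The witness 22 for \<open>C0\<close> is the exponent in
    \<open>doubling_const_power_le\<close>.\<close>
  fix m d :: nat and X Fm and Fd :: "(nat \<times> nat \<Rightarrow> real) \<Rightarrow> (nat \<Rightarrow> real) set"
  assume "X \<subseteq> topspace (Euclidean_space m)" "finite X" "X \<noteq> {}" "d \<ge> 1"
    "real d \<ge> 22 * doubling_dim m X" "fl_optimal m X Fm"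
    "\<forall>G \<in> space (gaussian_matrix d m). fl_optimal d (mat_apply d m G ` X) (Fd G)"
  then interpret projected_facility_location m d X Fm Fd
    by unfold_locales auto
  show "integrable (gaussian_matrix d m) proj_cost"
    by (rule integrable_proj_cost)
  show "100 / 2 ^ 23 / 3 * fl_cost m X Fm \<le> (\<integral>G. proj_cost G \<partial>gaussian_matrix d m)"
    by (rule expectation_proj_cost_ge)
  show "(\<integral>G. proj_cost G \<partial>gaussian_matrix d m) \<le> 1 * fl_cost m X Fm"
    using expectation_proj_cost_le by simp
qed simp_all

end
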